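(* Let $p\ge 13$ be a prime. Then $\mathrm{SL}(2,p)$, in its natural action on $\mathbb{F}_p^2\setminus\{0\}$, contains no sharply transitive subset.
   Context: Let $G$ be a transitive permutation group on a finite set $\Omega$. A subset $S\subseteq G$ is called sharply transitive (on $\Omega$) if for every ordered pair $(\alpha,\beta)\in\Omega\times\Omega$ there is a unique element $s\in S$ mapping $\alpha$ to $\beta$. Here $G=\mathrm{SL}(2,p)$ acts on the set of nonzero vectors $\mathbb{F}_p^2\setminus\{0\}$ by matrix multiplication. *)

theory Defs
  imports
    "HOL-Analysis.Determinants"
    "HOL-Computational_Algebra.Primes"
begin

text \<open>
  The set \<open>S\<close> consists of abstract elements that move points of \<open>\<Omega>\<close> through \<open>act\<close>, so the
  notion applies to matrices acting on vectors as well as to permutations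
  (\<open>act = (\<lambda>s. s)\<close>).
\<close>

definition sharply_transitive_on :: "('g \<Rightarrow> 'x \<Rightarrow> 'x) \<Rightarrow> 'x set \<Rightarrow> 'g set \<Rightarrow> bool" where
  "sharply_transitive_on act \<Omega> S \<longleftrightarrow>
     (\<forall>\<alpha>\<in>\<Omega>. \<forall>\<beta>\<in>\<Omega>. \<exists>!s. s \<in> S \<and> act s \<alpha> = \<beta>)"

definition SL2 :: "('a::field ^ 2 ^ 2) set" where
  "SL2 = {A. det A = 1}"

definition nonzero_vectors :: "('a::field ^ 2) set" where
  "nonzero_vectors = UNIV - {0}"

end

theory Submission
  imports Defs "HOL-Computational_Algebra.Polynomial"
begin

text \<open>
  Let \<open>q\<close> be the order of the prime field and \<open>S\<close> a sharply transitive subset of \<open>SL\<^sub>2\<close>, so that \<open>S\<close>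
  has \<open>q\<^sup>2 - 1\<close> elements. Choose \<open>k\<close> between 4 and \<open>q - 4\<close> such that \<open>k\<^sup>2 - 4\<close> is not a square in
  the field, and put \<open>d = k + 2\<close>. For each matrix \<open>h\<close> of determinant \<open>d\<close> let \<open>N(h)\<close> be the number
  of \<open>s \<in> S\<close> with \<open>trace (h s) = d\<close>. The residue of \<open>N(h)\<close> modulo \<open>q\<close> and the variance of \<open>N(h)\<close>
  cannot both be as \<open>S\<close> dictates.

  The residue: \<open>N(h) = k - 1\<close> in the field (\<open>card_trace_product_mod\<close>). The set \<open>T = h S\<close> is again
  sharply transitive, and all its elements have determinant \<open>d\<close>. For a fixed nonzero vector \<open>u\<close>,
  the sum over \<open>A \<in> T\<close> of a monomial in the coordinates of \<open>A u\<close> is the sum of this monomial over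
  all nonzero vectors, which is zero in degrees 1 to \<open>q - 1\<close>. Therefore the traces of the symmetric
  powers of degrees 1 to \<open>q - 1\<close> sum to zero over \<open>T\<close> (\<open>sum_lucas_U_trace\<close>). These traces are Lucas
  polynomials in the trace of \<open>A\<close>, and the indicator function of \<open>trace A = d\<close> is a combination of
  them together with a constant. Only the constant contributes to \<open>N(h)\<close>. Its value follows from
  the action of the Frobenius map on the roots of \<open>X\<^sup>2 - d X + d\<close>, whose discriminant is \<open>k\<^sup>2 - 4\<close>
  (\<open>lucas_U_card_nonsquare\<close>, \<open>card_trace_eq_mod\<close>).

  The variance: over all \<open>h\<close> of determinant \<open>d\<close>, the mean of \<open>N(h)\<close> is \<open>q - 1\<close> and its variance is
  at most \<open>3 q - 3\<close>. The second moment counts triples \<open>(h, s, t)\<close> with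
  \<open>trace (h s) = trace (h t) = d\<close>. For \<open>s \<noteq> t\<close> the matrices \<open>h\<close> form a conic. Its points at infinity
  correspond to the eigenlines of \<open>s\<^sup>-\<^sup>1 t\<close>, so that it has at most \<open>q + 1\<close> minus the number of
  eigenlines affine points (\<open>card_trace_trace_bound\<close>). The number of eigenlines, summed over \<open>t \<in> S\<close>,
  is known by sharp transitivity (\<open>sum_card_parallel\<close>). This gives the bound
  \<open>card_second_moment_row\<close>.

  The contradiction: every integer \<open>N\<close> congruent to \<open>r = k - 1\<close> modulo \<open>q\<close> satisfies
  \<open>(N - r) (N - r - q) \<ge> 0\<close>. By the bounds on the first two moments, the mean of this product over all \<open>h\<close>
  is at most \<open>3 q - 3 - k (q - k)\<close>. For \<open>q \<ge> 13\<close> the number \<open>k\<close> can be chosen such that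
  this is negative (\<open>exists_nonsquare_discriminant\<close>).
\<close>

section \<open>Finite prime fields\<close>

lemma of_nat_card_eq_0: "of_nat CARD('a::{field,finite}) = (0::'a)"
proof -
  have "(\<Sum>x\<in>UNIV. x + 1) = (\<Sum>x\<in>UNIV. x :: 'a)"
    by (rule sum.reindex_bij_witness[of _ "\<lambda>x. x - 1" "\<lambda>x. x + 1"]) auto
  then show ?thesis
    by (simp add: sum.distrib)
qed

lemma CHAR_eq_card:
  assumes "prime CARD('a::{field,finite})"
  shows "CHAR('a) = CARD('a)"
  using assms of_nat_card_eq_0[where 'a='a] of_nat_eq_0_iff_char_dvd[where 'a='a, of "CARD('a)"]
  by (metis CHAR_not_1 One_nat_def prime_nat_iff)

lemma power_card_minus_1:
  fixes x :: "'a::{field,finite}"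
  assumes "x \<noteq> 0"
  shows "x ^ (CARD('a) - 1) = 1"
proof -
  let ?N = "UNIV - {0::'a}"
  have "(\<Prod>y\<in>?N. y) = (\<Prod>y\<in>?N. x * y)"
    by (rule prod.reindex_bij_witness[of _ "\<lambda>y. x * y" "\<lambda>y. y / x"]) (use assms in auto)
  also have "\<dots> = x ^ (CARD('a) - 1) * (\<Prod>y\<in>?N. y)"
    by (simp add: prod.distrib)
  finally show ?thesis
    by simp
qed

lemma power_card_eq_same:
  fixes x :: "'a::{field,finite}"
  shows "x ^ CARD('a) = x"
proof (cases "x = 0")
  case False
  have "x ^ CARD('a) = x * x ^ (CARD('a) - 1)"
    by (metis One_nat_def Suc_pred power_Suc zero_less_card_finite)
  then show ?thesis
    using False power_card_minus_1 by auto
qed (simp add: power_0_left)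

text \<open>
  As \<open>k < q - 1\<close>, some nonzero \<open>z\<close> has \<open>z ^ k \<noteq> 1\<close>, and the substitution \<open>x \<mapsto> z x\<close> multiplies the
  sum by \<open>z ^ k\<close>.
\<close>

lemma power_sum_eq_0:
  assumes "k < CARD('a::{field,finite}) - 1"
  shows "(\<Sum>x\<in>UNIV. x ^ k) = (0::'a)"
proof (cases "k = 0")
  case True
  then show ?thesis
    using of_nat_card_eq_0[where 'a='a] by simp
next
  case False
  let ?P = "monom 1 k - 1 :: 'a poly"
  have coeffk: "coeff ?P k = 1"
    using False by (auto simp: coeff_1)
  then have nz: "?P \<noteq> 0"
    by (metis coeff_0 zero_neq_one)
  have "degree ?P \<le> k"
    by (rule degree_le) (auto simp: coeff_1)
  then have "card {x. poly ?P x = 0} \<le> k"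
    using card_poly_roots_bound[OF nz] by simp
  then have "card {x. poly ?P x = 0} < card (UNIV - {0::'a})"
    using assms by (simp add: card_Diff_singleton)
  then have "\<not> UNIV - {0::'a} \<subseteq> {x. poly ?P x = 0}"
    by (meson card_mono finite not_le)
  then obtain z :: 'a where z: "z \<noteq> 0" "z ^ k \<noteq> 1"
    by (auto simp: poly_monom)
  have "(\<Sum>x\<in>UNIV. x ^ k) = (\<Sum>x\<in>UNIV. (z * x) ^ k)"
    by (rule sum.reindex_bij_witness[of _ "\<lambda>y. z * y" "\<lambda>y. y / z"]) (use z in auto)
  also have "\<dots> = z ^ k * (\<Sum>x\<in>UNIV. x ^ k)"
    by (simp add: power_mult_distrib sum_distrib_left)
  finally show ?thesis
    using z by simp
qed

section \<open>Lucas sequences\<close>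

text \<open>
  If \<open>\<lambda>\<close> and \<open>\<mu>\<close> are the distinct roots of \<open>X\<^sup>2 - x X + d\<close>, then \<open>lucas_U x d n\<close> is
  \<open>(\<lambda> ^ n - \<mu> ^ n) / (\<lambda> - \<mu>)\<close> and \<open>lucas_V x d n\<close> is \<open>\<lambda> ^ n + \<mu> ^ n\<close>. The recursions make sense
  over a ring that does not contain the roots.
\<close>

fun lucas_U :: "'a::comm_ring_1 \<Rightarrow> 'a \<Rightarrow> nat \<Rightarrow> 'a" where
  "lucas_U x d 0 = 0"
| "lucas_U x d (Suc 0) = 1"
| "lucas_U x d (Suc (Suc n)) = x * lucas_U x d (Suc n) - d * lucas_U x d n"

fun lucas_V :: "'a::comm_ring_1 \<Rightarrow> 'a \<Rightarrow> nat \<Rightarrow> 'a" where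
  "lucas_V x d 0 = 2"
| "lucas_V x d (Suc 0) = x"
| "lucas_V x d (Suc (Suc n)) = x * lucas_V x d (Suc n) - d * lucas_V x d n"

lemma lucas_V_conv_U: "lucas_V x d n = 2 * lucas_U x d (Suc n) - x * lucas_U x d n"
proof (induction n rule: induct_nat_012)
  case (ge2 n)
  show ?case
    unfolding lucas_V.simps(3) ge2 by (simp add: algebra_simps)
qed simp_all

text \<open>
  This is the quotient of \<open>lucas_V x d n - lucas_V c d n\<close> by \<open>x - c\<close>, written as a combination
  of the polynomials \<open>lucas_U x d j\<close> with coefficients that depend on \<open>c\<close> only. For \<open>n = q\<close> over
  the prime field of order \<open>q\<close> it is the indicator function of \<open>x \<noteq> c\<close>, so it expands that
  function in the traces of symmetric powers.
\<close>

definition lucas_quotient :: "'a::comm_ring_1 \<Rightarrow> 'a \<Rightarrow> 'a \<Rightarrow> nat \<Rightarrow> 'a" where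
  "lucas_quotient c d x n = lucas_U x d n + (\<Sum>j=1..n. lucas_V c d j * lucas_U x d (n - j))"

lemma lucas_quotient_0: "lucas_quotient c d x 0 = 0"
  and lucas_quotient_1: "lucas_quotient c d x (Suc 0) = 1"
  by (simp_all add: lucas_quotient_def)

lemma lucas_quotient_rec:
  "lucas_quotient c d x (Suc (Suc n)) =
     x * lucas_quotient c d x (Suc n) - d * lucas_quotient c d x n + lucas_V c d (Suc n)"
proof -
  have "(\<Sum>j=1..n. lucas_V c d j * lucas_U x d (Suc (Suc n) - j)) =
        (\<Sum>j=1..n. x * (lucas_V c d j * lucas_U x d (Suc n - j)) -
                   d * (lucas_V c d j * lucas_U x d (n - j)))"
    by (rule sum.cong) (auto simp: Suc_diff_le algebra_simps)
  then show ?thesis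
    by (simp add: lucas_quotient_def sum_subtractf sum_distrib_left algebra_simps del: lucas_V.simps)
qed

lemma lucas_quotient_eq:
  "(x - c) * lucas_quotient c d x n = lucas_V x d n - lucas_V c d n"
proof (induction n rule: induct_nat_012)
  case (ge2 n)
  have "(x - c) * lucas_quotient c d x (Suc (Suc n)) =
      x * ((x - c) * lucas_quotient c d x (Suc n)) - d * ((x - c) * lucas_quotient c d x n)
      + (x - c) * lucas_V c d (Suc n)"
    unfolding lucas_quotient_rec by (simp add: algebra_simps)
  then show ?case
    unfolding ge2 by (simp add: algebra_simps)
qed (simp_all add: lucas_quotient_0 lucas_quotient_1)

text \<open>
  On the diagonal a divided difference becomes a derivative, and the derivative of
  \<open>lucas_V c d n\<close> with respect to \<open>c\<close> is \<open>n * lucas_U c d n\<close>.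
\<close>

lemma lucas_quotient_diagonal: "lucas_quotient c d c n = of_nat n * lucas_U c d n"
proof (induction n rule: induct_nat_012)
  case (ge2 n)
  then show ?case
    unfolding lucas_quotient_rec lucas_V_conv_U by (simp add: algebra_simps)
qed (simp_all add: lucas_quotient_0 lucas_quotient_1)

lemma quadratic_dvd_power_X:
  fixes c d :: "'a::comm_ring_1"
  shows "[:d, -c, 1:] dvd [:0, 1:] ^ Suc n - [:- d * lucas_U c d n, lucas_U c d (Suc n):]"
proof (induction n)
  case (Suc n)
  let ?m = "[:d, -c, 1:]"
  have "[:0, 1:] ^ Suc (Suc n) - [:- d * lucas_U c d (Suc n), lucas_U c d (Suc (Suc n)):] =
    [:0, 1:] * ([:0, 1:] ^ Suc n - [:- d * lucas_U c d n, lucas_U c d (Suc n):]) +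
    [:lucas_U c d (Suc n):] * ?m"
    by (simp add: algebra_simps)
  then show ?case
    using Suc by (metis dvd_add dvd_mult dvd_triv_right)
qed simp

text \<open>
  The two roots of \<open>Y\<^sup>2 - c Y + d\<close> in the ring of polynomials modulo \<open>X\<^sup>2 - c X + d\<close> are \<open>X\<close>
  and \<open>c - X\<close>; their power sums are the sequence \<open>lucas_V\<close>.
\<close>

lemma quadratic_dvd_power_sum:
  fixes c d :: "'a::comm_ring_1"
  shows "[:d, -c, 1:] dvd [:0, 1:] ^ n + [:c, -1:] ^ n - [:lucas_V c d n:]"
proof (induction n rule: induct_nat_012)
  case (ge2 n)
  let ?m = "[:d, -c, 1:]" and ?X = "[:0, 1:] :: 'a poly" and ?Y = "[:c, -1:]"
  let ?E = "\<lambda>n. ?X ^ n + ?Y ^ n - [:lucas_V c d n:]"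
  have X: "?X * ?X = [:c:] * ?X - [:d:] + ?m" and Y: "?Y * ?Y = [:c:] * ?Y - [:d:] + ?m"
    by simp_all
  have XX: "?X ^ Suc (Suc n) = ([:c:] * ?X - [:d:] + ?m) * ?X ^ n"
    by (simp only: X[symmetric] power_Suc mult.assoc)
  have YY: "?Y ^ Suc (Suc n) = ([:c:] * ?Y - [:d:] + ?m) * ?Y ^ n"
    by (simp only: Y[symmetric] power_Suc mult.assoc)
  have V: "[:lucas_V c d (Suc (Suc n)):] = [:c:] * [:lucas_V c d (Suc n):] - [:d:] * [:lucas_V c d n:]"
    by simp
  have "?E (Suc (Suc n)) = [:c:] * ?E (Suc n) - [:d:] * ?E n + (?X ^ n + ?Y ^ n) * ?m"
    unfolding XX YY V by (simp only: power_Suc ring_distribs mult_ac) (simp only: algebra_simps)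
  then show ?case
    using ge2 by (metis dvd_add dvd_diff dvd_mult dvd_triv_right)
next
  case 0
  show ?case
    by (simp add: numeral_poly)
qed simp_all

text \<open>
  The Frobenius map is additive, hence \<open>X ^ q + (c - X) ^ q = c ^ q = c\<close>.
\<close>

lemma lucas_V_card:
  fixes c d :: "'a::{field,finite}"
  assumes "prime CARD('a)"
  shows "lucas_V c d CARD('a) = c"
proof -
  let ?q = "CARD('a)"
  have char: "CHAR('a poly) = ?q"
    using CHAR_eq_card[OF assms] by simp
  have "([:0, 1:] + [:c, -1:]) ^ ?q = [:0, 1:] ^ ?q + [:c, -1::'a:] ^ ?q"
    using freshmans_dream[where 'a = "'a poly"] char assms by metis
  moreover have "([:0, 1:] + [:c, -1:]) ^ ?q = [:c ^ ?q:]"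
    by (simp add: poly_const_pow)
  ultimately have "[:d, -c, 1:] dvd [:c:] - [:lucas_V c d ?q:]"
    using quadratic_dvd_power_sum[of d c ?q] by (simp add: power_card_eq_same)
  then have "[:d, -c, 1:] dvd [:c - lucas_V c d ?q:]"
    by simp
  then have "c - lucas_V c d ?q = 0"
    using dvd_imp_degree_le by fastforce
  then show ?thesis
    by simp
qed

text \<open>
  The discriminant is not a square, so the Frobenius map exchanges the two roots of
  \<open>X\<^sup>2 - c X + d\<close>: modulo this polynomial, \<open>X ^ q\<close> is \<open>c - X\<close>. Comparison with
  \<open>X ^ q = U\<^sub>q X - d U\<^sub>q\<^sub>-\<^sub>1\<close> gives both values. The proof computes the Frobenius image of
  \<open>2 X - c\<close>, a square root of the discriminant \<open>\<delta>\<close>, as \<open>\<delta> ^ ((q - 1) / 2)\<close> times itself. The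
  scalar is \<open>1\<close> or \<open>-1\<close>.
\<close>

lemma lucas_U_card_nonsquare:
  fixes c d :: "'a::{field,finite}"
  assumes prime: "prime CARD('a)" and odd: "odd CARD('a)"
    and nonsquare: "\<nexists>y. y\<^sup>2 = c\<^sup>2 - 4 * d"
  shows "lucas_U c d CARD('a) = -1" and "d * lucas_U c d (CARD('a) - 1) = - c"
proof -
  let ?q = "CARD('a)" and ?m = "[:d, -c, 1:]" and ?X = "[:0, 1:] :: 'a poly" and ?L = "[:-c, 2:]"
  obtain k where k: "?q = Suc (2 * k)"
    using odd by (metis oddE Suc_eq_plus1)
  define u w where "u = lucas_U c d ?q" and "w = d * lucas_U c d (?q - 1)"
  define \<kappa> where "\<kappa> = (c\<^sup>2 - 4 * d) ^ k"
  have two: "(2::'a) \<noteq> 0"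
  proof -
    have "\<not> CHAR('a) dvd 2"
      unfolding CHAR_eq_card[OF prime] using prime odd
      by (metis even_numeral dvd_refl primes_dvd_imp_eq two_is_prime_nat)
    then show ?thesis
      using of_nat_eq_0_iff_char_dvd[where 'a='a, of 2] by simp
  qed
  have no_root: "poly ?m a \<noteq> 0" for a
  proof
    assume "poly ?m a = 0"
    then have "(2 * a - c)\<^sup>2 = c\<^sup>2 - 4 * d"
      by (simp add: power2_eq_square) algebra
    with nonsquare show False by blast
  qed
  have linear_eq_0: "P = 0" if "?m dvd P" "degree P \<le> 1" for P
    using dvd_imp_degree_le[OF that(1)] that(2) by auto
  have X: "?m dvd ?X ^ ?q - [:-w, u:]"
    using quadratic_dvd_power_X[of d c "2 * k"] by (simp add: k w_def u_def)
  have "?m dvd ?L\<^sup>2 - [:c\<^sup>2 - 4 * d:]"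
    by (rule dvdI[of _ _ 4]) (simp add: numeral_poly power2_eq_square)
  also have "\<dots> dvd (?L\<^sup>2) ^ k - [:c\<^sup>2 - 4 * d:] ^ k"
    by (simp add: power_diff_sumr2)
  finally have "?m dvd ?L * ((?L\<^sup>2) ^ k - [:c\<^sup>2 - 4 * d:] ^ k)"
    by (rule dvd_mult)
  then have L: "?m dvd ?L ^ ?q - [:\<kappa>:] * ?L"
    by (simp only: k power_Suc power_mult[of _ 2 k] \<kappa>_def poly_const_pow right_diff_distrib
        mult.commute[of "[:(c\<^sup>2 - 4 * d) ^ k:]"])
  have "CHAR('a poly) = ?q"
    using CHAR_eq_card[OF prime] by simp
  then have "([:2:] * ?X + [:-c:]) ^ ?q = ([:2:] * ?X) ^ ?q + [:-c:] ^ ?q"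
    using freshmans_dream[where 'a = "'a poly"] prime by metis
  then have "?L ^ ?q = [:2:] * ?X ^ ?q + [:-c:]"
    unfolding power_mult_distrib by (simp add: poly_const_pow power_card_eq_same)
  then have "(?L ^ ?q - [:\<kappa>:] * ?L) - [:2:] * (?X ^ ?q - [:-w, u:]) =
      [:- 2 * w - c + \<kappa> * c, 2 * u - 2 * \<kappa>:]"
    by (simp add: algebra_simps)
  moreover have "?m dvd (?L ^ ?q - [:\<kappa>:] * ?L) - [:2:] * (?X ^ ?q - [:-w, u:])"
    by (rule dvd_diff[OF L dvd_mult[OF X]])
  ultimately have "?m dvd [:- 2 * w - c + \<kappa> * c, 2 * u - 2 * \<kappa>:]"
    by metis
  then have "[:- 2 * w - c + \<kappa> * c, 2 * u - 2 * \<kappa>:] = 0"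
    by (rule linear_eq_0) simp
  then have u: "u = \<kappa>" and w: "2 * w = \<kappa> * c - c"
    using two by (simp_all add: algebra_simps)
  have "c\<^sup>2 - 4 * d \<noteq> 0"
    using nonsquare[simplified, rule_format, of 0] by auto
  then have "\<kappa>\<^sup>2 = 1"
    using power_card_minus_1[of "c\<^sup>2 - 4 * d"] by (simp add: \<kappa>_def k power_mult[symmetric] mult.commute)
  \<comment> \<open>For \<open>\<kappa> = 1\<close> the quadratic would divide \<open>X ^ q - X\<close>, which has all \<open>q\<close> elements of the field
    as roots. The cofactor is too small to account for all of them.\<close>
  moreover have "\<kappa> \<noteq> 1"
  proof
    assume "\<kappa> = 1"
    then have "?m dvd ?X ^ ?q - ?X"
      using X u w two by simp
    then obtain Q where Q: "?X ^ ?q - ?X = ?m * Q" ..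
    have q1: "?q > 1"
      using prime prime_gt_1_nat by blast
    have "degree (- ?X + ?X ^ ?q) = degree (?X ^ ?q)"
      using q1 by (intro degree_add_eq_right) (simp add: degree_linear_power)
    then have deg: "degree (?X ^ ?q - ?X) = ?q"
      by (simp add: degree_linear_power del: minus_pCons)
    have nz: "Q \<noteq> 0"
    proof
      assume "Q = 0"
      then show False using Q deg q1 by simp
    qed
    then have "degree Q + 2 = ?q"
      using Q deg degree_mult_eq[of ?m Q] by simp
    then have "card {a. poly Q a = 0} < card (UNIV :: 'a set)"
      using card_poly_roots_bound[OF nz] by linarith
    then obtain a where "poly Q a \<noteq> 0"
      by (metis (mono_tags) UNIV_eq_I mem_Collect_eq nat_less_le)
    moreover have "poly (?m * Q) a = 0"
      unfolding Q[symmetric] by (simp add: power_card_eq_same)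
    ultimately show False
      using no_root[of a] by (metis poly_mult mult_eq_0_iff)
  qed
  ultimately have "\<kappa> = -1"
    by (simp add: power2_eq_1_iff)
  then have "u = -1" and "2 * (w + c) = 0"
    using u w by (simp_all add: algebra_simps)
  then show "lucas_U c d ?q = -1" "d * lucas_U c d (?q - 1) = - c"
    using two unfolding u_def w_def mult_eq_0_iff by (simp_all only: eq_neg_iff_add_eq_0 simp_thms)
qed

section \<open>Traces of symmetric powers\<close>

text \<open>
  A matrix acts on homogeneous polynomials of degree \<open>i + j\<close> in \<open>u\<^sub>1\<close> and \<open>u\<^sub>2\<close> by substitution.
  This is the coefficient of \<open>u\<^sub>1 ^ i * u\<^sub>2 ^ j\<close> in the image of that same monomial (with \<open>u\<^sub>2\<close>
  set to 1), that is, a diagonal entry of the matrix of the symmetric power of degree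
  \<open>i + j\<close>.
\<close>

definition weight_coeff :: "nat \<Rightarrow> nat \<Rightarrow> 'a::comm_ring_1 ^ 2 ^ 2 \<Rightarrow> 'a" where
  "weight_coeff i j A = coeff ([:A$1$2, A$1$1:] ^ i * [:A$2$2, A$2$1:] ^ j) i"

lemma weight_coeff_rec:
  "weight_coeff (Suc i) (Suc j) A =
     A$1$1 * weight_coeff i (Suc j) A + A$2$2 * weight_coeff (Suc i) j A - det A * weight_coeff i j A"
  by (cases i) (simp_all add: weight_coeff_def det_2 mult.assoc mult.left_commute algebra_simps)

lemma coeff_linear_power_0: "coeff ([:b, a:] ^ n) 0 = (b::'a::comm_ring_1) ^ n"
  by (simp add: coeff_0_power)

lemma coeff_linear_power_top: "coeff ([:b, a:] ^ n) n = (a::'a::comm_ring_1) ^ n"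
proof (induction n)
  case (Suc n)
  have "degree ([:b, a:] ^ n) \<le> n"
    using degree_power_le[of "[:b, a:]" n] by (simp add: degree_pCons_eq_if split: if_splits)
  then have "coeff ([:b, a:] ^ n) (Suc n) = 0"
    by (simp add: coeff_eq_0)
  then show ?case
    using Suc by simp
qed simp

text \<open>
  The trace of the \<open>n\<close>-th symmetric power of a matrix with eigenvalues \<open>\<lambda>\<close>, \<open>\<mu>\<close> is
  \<open>\<Sum>i\<le>n. \<lambda> ^ i * \<mu> ^ (n - i)\<close>. The recursion for \<open>weight_coeff\<close> yields this
  without eigenvalues: summed over \<open>i + j = n\<close> it becomes the Lucas recursion, up to boundary
  terms which cancel.
\<close>

lemma sum_weight_coeff:
  "(\<Sum>i\<le>n. weight_coeff i (n - i) A) = lucas_U (trace A) (det A) (Suc n)"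
proof (induction n rule: induct_nat_012)
  case 0
  show ?case by (simp add: weight_coeff_def)
next
  case 1
  show ?case by (simp add: weight_coeff_def trace_def sum_2)
next
  case (ge2 n)
  let ?W = "\<lambda>i j. weight_coeff i j A" and ?a = "A$1$1" and ?d = "A$2$2"
  have edge: "?W k 0 = ?a ^ k" "?W 0 k = ?d ^ k" for k
    by (simp_all add: weight_coeff_def coeff_linear_power_top coeff_linear_power_0)
  have "(\<Sum>i\<le>Suc (Suc n). ?W i (Suc (Suc n) - i)) =
      ?d ^ Suc (Suc n) + (\<Sum>i\<le>n. ?W (Suc i) (Suc (n - i))) + ?a ^ Suc (Suc n)"
    by (simp add: sum.atMost_Suc_shift[of _ "Suc n"] edge Suc_diff_le del: sum.atMost_Suc power_Suc)
       (simp add: edge Suc_diff_le)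
  also have "(\<Sum>i\<le>n. ?W (Suc i) (Suc (n - i))) =
      ?a * (\<Sum>i\<le>n. ?W i (Suc (n - i))) + ?d * (\<Sum>i\<le>n. ?W (Suc i) (n - i))
      - det A * (\<Sum>i\<le>n. ?W i (n - i))"
    by (simp add: weight_coeff_rec sum.distrib sum_subtractf sum_distrib_left)
  also have "(\<Sum>i\<le>n. ?W i (Suc (n - i))) = (\<Sum>i\<le>Suc n. ?W i (Suc n - i)) - ?a ^ Suc n"
    by (simp add: edge Suc_diff_le)
  also have "(\<Sum>i\<le>n. ?W (Suc i) (n - i)) = (\<Sum>i\<le>Suc n. ?W i (Suc n - i)) - ?d ^ Suc n"
    by (simp add: sum.atMost_Suc_shift edge del: sum.atMost_Suc)
  finally show ?case
    unfolding ge2 by (simp add: trace_def sum_2 algebra_simps)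
qed

section \<open>Sharply transitive sets of matrices of constant determinant\<close>

lemma matrix_vector_mult_2:
  "(A *v u) $ 1 = A$1$1 * u$1 + A$1$2 * u$2" "(A *v u) $ 2 = A$2$1 * u$1 + A$2$2 * u$2"
  for A :: "'a::comm_ring_1 ^ 2 ^ 2"
  by (simp_all add: matrix_vector_mult_def sum_2)

lemma matrix_vector_mult_nonzero:
  fixes A :: "'a::field ^ 2 ^ 2"
  assumes "det A \<noteq> 0" "u \<noteq> 0"
  shows "A *v u \<noteq> 0"
  using assms by (metis invertible_det_nz invertible_def matrix_vector_mul_assoc
      matrix_vector_mul_lid matrix_vector_mult_0_right)

lemma sharply_transitive_bij_betw:
  fixes T :: "('a::field ^ 2 ^ 2) set"
  assumes "sharply_transitive_on (*v) nonzero_vectors T" and "\<forall>A\<in>T. det A \<noteq> 0" and "u \<noteq> 0"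
  shows "bij_betw (\<lambda>A. A *v u) T nonzero_vectors"
proof (rule bij_betw_imageI)
  have u: "u \<in> nonzero_vectors"
    using assms by (simp add: nonzero_vectors_def)
  have nz: "A *v u \<in> nonzero_vectors" if "A \<in> T" for A
    using assms that matrix_vector_mult_nonzero by (auto simp: nonzero_vectors_def)
  show "inj_on (\<lambda>A. A *v u) T"
    using assms(1) u nz unfolding sharply_transitive_on_def inj_on_def by metis
  show "(\<lambda>A. A *v u) ` T = nonzero_vectors"
    using assms(1) u nz unfolding sharply_transitive_on_def by (fastforce simp: image_iff)
qed

lemma card_nonzero_vectors: "card (nonzero_vectors :: ('a::{field,finite} ^ 2) set) = CARD('a)\<^sup>2 - 1"
  by (simp add: nonzero_vectors_def card_Diff_singleton)

lemma card_sharply_transitive: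
  fixes T :: "('a::{field,finite} ^ 2 ^ 2) set"
  assumes "sharply_transitive_on (*v) nonzero_vectors T" and "\<forall>A\<in>T. det A \<noteq> 0"
  shows "card T = CARD('a)\<^sup>2 - 1"
  using bij_betw_same_card[OF sharply_transitive_bij_betw[OF assms, of 1]] card_nonzero_vectors
  by (metis one_index zero_index zero_neq_one)

text \<open>
  One of the two exponents is less than \<open>q - 1\<close>, and the corresponding power sum vanishes.
\<close>

lemma sum_nonzero_vectors_monomial:
  assumes "0 < i + j" and "i + j < CARD('a::{field,finite})"
  shows "(\<Sum>v\<in>nonzero_vectors. v$1 ^ i * v$2 ^ j) = (0::'a)"
proof -
  have "(\<Sum>v\<in>nonzero_vectors. v$1 ^ i * v$2 ^ j) = (\<Sum>v\<in>(UNIV :: ('a ^ 2) set). v$1 ^ i * v$2 ^ j)"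
    using assms(1) by (intro sum.mono_neutral_left) (auto simp: nonzero_vectors_def power_0_left)
  also have "\<dots> = (\<Sum>(x, y)\<in>UNIV. x ^ i * y ^ j)"
    by (rule sum.reindex_bij_witness[of _ "\<lambda>(x, y). vector [x, y]" "\<lambda>v. (v$1, v$2)"])
       (auto simp: vec_eq_iff forall_2)
  also have "\<dots> = (\<Sum>x\<in>UNIV. x ^ i) * (\<Sum>y\<in>UNIV. y ^ j)"
    by (simp add: UNIV_Times_UNIV[symmetric] sum.cartesian_product[symmetric] sum_product del: UNIV_Times_UNIV)
  also have "\<dots> = 0"
  proof -
    have "i < CARD('a) - 1 \<or> j < CARD('a) - 1"
      using assms by linarith
    then show ?thesis
      using power_sum_eq_0[where 'a='a] by auto
  qed
  finally show ?thesis .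
qed

text \<open>
  For a fixed vector \<open>u = (x, 1)\<close> the images \<open>A *v u\<close> run through all nonzero vectors exactly once, so
  the sum over \<open>A\<close> of \<open>v\<^sub>1 ^ i * v\<^sub>2 ^ j\<close> at \<open>v = A *v u\<close> is zero. As a function of \<open>x\<close> this sum is a
  polynomial of degree less than \<open>q\<close> with \<open>q\<close> zeros, so each of its coefficients is zero.
\<close>

lemma sum_weight_coeff_eq_0:
  fixes T :: "('a::{field,finite} ^ 2 ^ 2) set"
  assumes sharp: "sharply_transitive_on (*v) nonzero_vectors T" "\<forall>A\<in>T. det A \<noteq> 0"
    and ij: "0 < i + j" "i + j < CARD('a)"
  shows "(\<Sum>A\<in>T. weight_coeff i j A) = 0"
proof -
  let ?P = "\<Sum>A\<in>T. [:A$1$2, A$1$1:] ^ i * [:A$2$2, A$2$1:] ^ j"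
  have "degree [:a, b:] \<le> 1" for a b :: 'a
    by simp
  then have lin: "degree ([:a, b:] ^ n) \<le> n" for a b :: 'a and n
    by (metis degree_power_le le_trans mult_le_mono1 nat_mult_1)
  have "degree ?P \<le> i + j"
    by (intro degree_sum_le degree_mult_le[THEN order_trans] add_mono lin) simp
  have "poly ?P x = 0" for x
  proof -
    let ?u = "vector [x, 1] :: 'a ^ 2"
    have "?u \<noteq> 0"
      by (metis vector_2(2) zero_index zero_neq_one)
    have "poly ?P x = (\<Sum>A\<in>T. (A *v ?u)$1 ^ i * (A *v ?u)$2 ^ j)"
      by (simp add: poly_sum matrix_vector_mult_2 algebra_simps)
    also have "\<dots> = (\<Sum>v\<in>nonzero_vectors. v$1 ^ i * v$2 ^ j)"
      using sum.reindex_bij_betw[OF sharply_transitive_bij_betw[OF sharp \<open>?u \<noteq> 0\<close>]] by simp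
    finally show ?thesis
      using sum_nonzero_vectors_monomial[OF ij] by simp
  qed
  then have "{x. poly ?P x = 0} = UNIV"
    by blast
  then have "?P = 0"
    using card_poly_roots_bound[of ?P] \<open>degree ?P \<le> i + j\<close> ij by fastforce
  then show ?thesis
    unfolding weight_coeff_def by (simp add: coeff_sum[symmetric])
qed

lemma sum_lucas_U_trace:
  fixes T :: "('a::{field,finite} ^ 2 ^ 2) set"
  assumes sharp: "sharply_transitive_on (*v) nonzero_vectors T" and det: "\<forall>A\<in>T. det A = d" and "d \<noteq> 0"
    and n: "0 < n" "n < CARD('a)"
  shows "(\<Sum>A\<in>T. lucas_U (trace A) d (Suc n)) = 0"
proof -
  have "(\<Sum>A\<in>T. lucas_U (trace A) d (Suc n)) = (\<Sum>A\<in>T. \<Sum>i\<le>n. weight_coeff i (n - i) A)"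
    by (rule sum.cong) (simp_all add: sum_weight_coeff det)
  also have "\<dots> = (\<Sum>i\<le>n. \<Sum>A\<in>T. weight_coeff i (n - i) A)"
    by (rule sum.swap)
  also have "\<dots> = 0"
    using n det \<open>d \<noteq> 0\<close> by (intro sum.neutral ballI sum_weight_coeff_eq_0[OF sharp]) auto
  finally show ?thesis .
qed

text \<open>
  The sum over \<open>T\<close> of \<open>lucas_quotient c d (trace A) q\<close> is evaluated twice. This function of the trace
  is 0 for trace \<open>c\<close> and 1 otherwise, so the sum is \<open>card T\<close> minus the number in question. On the
  other hand the function is a combination of traces of symmetric powers, whose sums over \<open>T\<close>
  vanish in all degrees but 0. What remains is the coefficient of degree 0, and it is
  \<open>V\<^sub>q\<^sub>-\<^sub>1 = c\<^sup>2 / d - 2\<close>.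
\<close>

proposition card_trace_eq_mod:
  fixes T :: "('a::{field,finite} ^ 2 ^ 2) set"
  assumes prime: "prime CARD('a)" and odd: "odd CARD('a)"
    and sharp: "sharply_transitive_on (*v) nonzero_vectors T" and det: "\<forall>A\<in>T. det A = d" and "d \<noteq> 0"
    and nonsquare: "\<nexists>y. y\<^sup>2 = c\<^sup>2 - 4 * d"
  shows "of_nat (card {A \<in> T. trace A = c}) = c\<^sup>2 / d - 3"
proof -
  let ?q = "CARD('a)" and ?N = "of_nat (card {A \<in> T. trace A = c}) :: 'a"
  obtain n where n: "?q = Suc (Suc n)"
    using prime_ge_2_nat[OF prime] by (metis add_2_eq_Suc le_Suc_ex)
  have q0: "of_nat ?q = (0::'a)"
    by (rule of_nat_card_eq_0)
  have "of_nat (card T) = (of_nat ?q ^ 2 - 1 :: 'a)"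
    using card_sharply_transitive[OF sharp] det \<open>d \<noteq> 0\<close>
    by (simp add: of_nat_diff n del: of_nat_Suc) simp
  then have cardT: "of_nat (card T) = (-1 :: 'a)"
    by (simp add: q0)
  have quotient: "lucas_quotient c d x ?q = (if x = c then 0 else 1)" for x
    using lucas_quotient_diagonal[of c d ?q] lucas_quotient_eq[of x c d ?q]
    by (auto simp: q0 lucas_V_card[OF prime])
  have "(\<Sum>A\<in>T. lucas_quotient c d (trace A) ?q) = (\<Sum>A\<in>T. 1 - (if trace A = c then 1 else 0))"
    by (rule sum.cong) (auto simp: quotient)
  also have "\<dots> = -1 - ?N"
    by (simp add: sum_subtractf cardT sum.If_cases Int_def)
  finally have lhs: "(\<Sum>A\<in>T. lucas_quotient c d (trace A) ?q) = -1 - ?N" .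
  have zero: "(\<Sum>A\<in>T. lucas_U (trace A) d k) = (if k = 1 then -1 else 0)" if "k \<le> ?q" for k
  proof (cases "k \<le> 1")
    case True
    then show ?thesis
      by (cases k) (simp_all add: cardT)
  next
    case False
    then show ?thesis
      using that sum_lucas_U_trace[OF sharp det \<open>d \<noteq> 0\<close>, of "k - 1"] by simp
  qed
  have "(\<Sum>A\<in>T. lucas_quotient c d (trace A) ?q) =
      (\<Sum>A\<in>T. lucas_U (trace A) d ?q) + (\<Sum>j=1..?q. lucas_V c d j * (\<Sum>A\<in>T. lucas_U (trace A) d (?q - j)))"
    unfolding lucas_quotient_def sum.distrib by (simp add: sum.swap[of _ _ T] sum_distrib_left)
  also have "\<dots> = (\<Sum>j=1..?q. lucas_V c d j * (if j = ?q - 1 then -1 else 0))"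
  proof -
    have "?q - j = 1 \<longleftrightarrow> j = ?q - 1" if "j \<in> {1..?q}" for j
      using that n by auto
    then show ?thesis
      using zero[of ?q] n by (simp add: zero)
  qed
  also have "\<dots> = - lucas_V c d (?q - 1)"
    by (simp add: n if_distrib cong: if_cong)
  also have "lucas_V c d (?q - 1) = 2 * lucas_U c d ?q - c * lucas_U c d (?q - 1)"
    by (simp add: n lucas_V_conv_U del: lucas_U.simps lucas_V.simps)
  also have "\<dots> = -2 + c\<^sup>2 / d"
  proof -
    have "lucas_U c d (?q - 1) = - c / d"
      using lucas_U_card_nonsquare(2)[OF prime odd nonsquare] \<open>d \<noteq> 0\<close> by (simp add: field_simps)
    then show ?thesis
      using lucas_U_card_nonsquare(1)[OF prime odd nonsquare] by (simp add: power2_eq_square)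
  qed
  finally show ?thesis
    using lhs by (simp add: algebra_simps)
qed

section \<open>Counting points of a conic by projection\<close>

lemma card_plane_le:
  fixes \<alpha> \<beta> \<gamma> :: "'a::{field,finite}"
  assumes "(\<alpha>, \<beta>, \<gamma>) \<noteq> (0, 0, 0)"
  shows "card {(x, y, z). \<alpha> * x + \<beta> * y + \<gamma> * z = 0} \<le> CARD('a)\<^sup>2"
    (is "card ?M \<le> _")
proof -
  have "\<exists>f :: 'a \<times> 'a \<times> 'a \<Rightarrow> 'a \<times> 'a. inj_on f ?M"
  proof -
    consider "\<alpha> \<noteq> 0" | "\<beta> \<noteq> 0" | "\<gamma> \<noteq> 0"
      using assms by auto
    then show ?thesis
    proof cases
      case 1
      have "inj_on (\<lambda>(x, y, z). (y, z)) ?M"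
        using 1 by (auto simp: inj_on_def) (metis add_right_cancel mult_cancel_left)
      then show ?thesis by blast
    next
      case 2
      have "inj_on (\<lambda>(x, y, z). (x, z)) ?M"
        using 2 by (auto simp: inj_on_def) (metis add_left_cancel add_right_cancel mult_cancel_left)
      then show ?thesis by blast
    next
      case 3
      have "inj_on (\<lambda>(x, y, z). (x, y)) ?M"
        using 3 by (auto simp: inj_on_def) (metis add_left_cancel mult_cancel_left)
      then show ?thesis by blast
    qed
  qed
  then obtain f :: "'a \<times> 'a \<times> 'a \<Rightarrow> 'a \<times> 'a" where "inj_on f ?M" ..
  then have "card ?M \<le> card (UNIV :: ('a \<times> 'a) set)"
    by (intro card_inj_on_le[of f]) auto
  then show ?thesis
    by (simp add: power2_eq_square)
qed

text \<open>
  By the pigeonhole principle, the pair of linear forms is not injective on triples.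
\<close>

lemma orthogonal_to_two_vectors:
  fixes \<alpha> \<beta> \<gamma> \<alpha>' \<beta>' \<gamma>' :: "'a::{field,finite}"
  obtains x y z where "(x, y, z) \<noteq> (0, 0, 0)"
    "\<alpha> * x + \<beta> * y + \<gamma> * z = 0" "\<alpha>' * x + \<beta>' * y + \<gamma>' * z = 0"
proof -
  define f where "f = (\<lambda>(x, y, z). (\<alpha> * x + \<beta> * y + \<gamma> * z, \<alpha>' * x + \<beta>' * y + \<gamma>' * z))"
  have "CARD('a) > 1"
    using card_mono[of UNIV "{0, 1 :: 'a}"] by simp
  then have "card (UNIV :: ('a \<times> 'a) set) < card (UNIV :: ('a \<times> 'a \<times> 'a) set)"
    by simp
  then have "\<not> inj f"
    using card_inj_on_le[of f UNIV UNIV] by auto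
  then obtain x y z x' y' z' where "(x, y, z) \<noteq> (x', y', z')" "f (x, y, z) = f (x', y', z')"
    unfolding inj_def by (metis surj_pair)
  then show thesis
    by (intro that[of "x - x'" "y - y'" "z - z'"]) (auto simp: f_def algebra_simps)
qed

text \<open>
  The matrices with rows \<open>(x, y)\<close> and \<open>(z, t - x)\<close> have trace \<open>t\<close>, and those of determinant \<open>d\<close> form
  a quadric surface. The set \<open>K\<close> is its section by a plane and \<open>I\<close> consists of the isotropic
  directions of this plane, that is, of the points of the conic at infinity. The claim is that
  the conic has at most \<open>q + 1\<close> points, those at infinity included. If \<open>K\<close> is not empty, it is
  projected from one of its points: every other point of \<open>K\<close> is determined by its direction,
  and neither an isotropic direction nor a tangent direction occurs. At least one direction in the
  plane is tangent. It is not isotropic, since the surface contains no affine line over the field,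
  as \<open>t\<^sup>2 - 4 d\<close> is not a square.
\<close>

lemma card_conic_bound:
  fixes \<alpha> \<beta> \<gamma> \<kappa> t d :: "'a::{field,finite}"
  assumes nonsquare: "\<nexists>y. y\<^sup>2 = t\<^sup>2 - 4 * d" and nz: "(\<alpha>, \<beta>, \<gamma>) \<noteq> (0, 0, 0)"
  defines "K \<equiv> {(x, y, z). x * (t - x) - y * z = d \<and> \<alpha> * x + \<beta> * y + \<gamma> * z = \<kappa>}"
  defines "I \<equiv> {(x, y, z). (x, y, z) \<noteq> (0, 0, 0) \<and> \<alpha> * x + \<beta> * y + \<gamma> * z = 0 \<and> x\<^sup>2 + y * z = 0}"
  shows "(CARD('a) - 1) * card K + card I \<le> CARD('a)\<^sup>2 - 1"
proof -
  let ?q = "CARD('a)"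
  define M where "M = {(x, y, z). (x, y, z) \<noteq> (0, 0, 0) \<and> \<alpha> * x + \<beta> * y + \<gamma> * z = 0}"
  have "M = {(x, y, z). \<alpha> * x + \<beta> * y + \<gamma> * z = 0} - {(0, 0, 0)}"
    by (auto simp: M_def)
  then have M: "card M \<le> ?q\<^sup>2 - 1"
    using card_plane_le[OF nz] by (simp add: card_Diff_singleton)
  show ?thesis
  proof (cases "K = {}")
    case True
    have "card I \<le> card M"
      by (rule card_mono) (auto simp: I_def M_def)
    then show ?thesis
      using M True by simp
  next
    case False
    then obtain x0 y0 z0 where "(x0, y0, z0) \<in> K"
      by auto
    then have P0: "x0 * (t - x0) - y0 * z0 = d" "\<alpha> * x0 + \<beta> * y0 + \<gamma> * z0 = \<kappa>"
      by (auto simp: K_def)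
    \<comment> \<open>On the line \<open>P\<^sub>0 + r m\<close> the quadric takes the value \<open>d + r l(m) - r\<^sup>2 Q(m)\<close>.\<close>
    define l where "l = (\<lambda>(x, y, z). (t - 2 * x0) * x + (- z0) * y + (- y0) * z)"
    define Q where "Q = (\<lambda>(x, y, z). x\<^sup>2 + y * z :: 'a)"
    define T where "T = {m \<in> M. l m = 0}"
    define X where "X = {m \<in> M. l m \<noteq> 0 \<and> Q m \<noteq> 0}"
    have I: "I = {m \<in> M. Q m = 0}"
      by (auto simp: I_def M_def Q_def)
    \<comment> \<open>On the surface neither \<open>y\<close> nor \<open>z\<close> is ever zero, but every affine line with a direction
      other than the first axis meets \<open>y = 0\<close> or \<open>z = 0\<close>.\<close>
    have no_zero: "x * (t - x) \<noteq> d" for x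
    proof
      assume d: "x * (t - x) = d"
      have "(2 * x - t)\<^sup>2 = t\<^sup>2 - 4 * d"
        unfolding d[symmetric] by (simp add: power2_eq_square algebra_simps)
      with nonsquare show False by blast
    qed
    have disjoint: "I \<inter> T = {}"
    proof -
      have False if m: "(x, y, z) \<noteq> (0, 0, 0)" "Q (x, y, z) = 0" "l (x, y, z) = 0" for x y z
      proof -
        have line: "(x0 + r * x) * (t - (x0 + r * x)) - (y0 + r * y) * (z0 + r * z) = d" for r
        proof -
          have "(x0 + r * x) * (t - (x0 + r * x)) - (y0 + r * y) * (z0 + r * z) =
              (x0 * (t - x0) - y0 * z0) + r * l (x, y, z) - r\<^sup>2 * Q (x, y, z)"
            by (simp add: l_def Q_def power2_eq_square algebra_simps)
          then show ?thesis
            using m P0 by simp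
        qed
        have "y \<noteq> 0 \<or> z \<noteq> 0"
          using m by (auto simp: Q_def)
        then show False
        proof
          assume "y \<noteq> 0"
          then show False
            using line[of "- y0 / y"] no_zero by auto
        next
          assume "z \<noteq> 0"
          then show False
            using line[of "- z0 / z"] no_zero by auto
        qed
      qed
      then show ?thesis
        by (auto simp: I T_def M_def)
    qed
    have T: "?q - 1 \<le> card T"
    proof -
      obtain x y z where m: "(x, y, z) \<noteq> (0, 0, 0)" "\<alpha> * x + \<beta> * y + \<gamma> * z = 0"
        "(t - 2 * x0) * x + (- z0) * y + (- y0) * z = 0"
        by (rule orthogonal_to_two_vectors)
      have "(\<lambda>r. (r * x, r * y, r * z)) ` (UNIV - {0}) \<subseteq> T"
      proof -
        have "\<alpha> * (r * x) + \<beta> * (r * y) + \<gamma> * (r * z) = r * (\<alpha> * x + \<beta> * y + \<gamma> * z)" for r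
          by (simp add: algebra_simps)
        moreover have "l (r * x, r * y, r * z) = r * ((t - 2 * x0) * x + (- z0) * y + (- y0) * z)" for r
          by (simp add: l_def algebra_simps)
        ultimately show ?thesis
          using m by (auto simp: T_def M_def simp del: mult_minus_left)
      qed
      moreover have "inj_on (\<lambda>r. (r * x, r * y, r * z)) (UNIV - {0})"
        using m(1) by (auto simp: inj_on_def)
      ultimately have "card (UNIV - {0::'a}) \<le> card T"
        by (intro card_inj_on_le) auto
      then show ?thesis
        by (simp add: card_Diff_singleton)
    qed
    \<comment> \<open>Directions are counted as nonzero vectors, each with its \<open>q - 1\<close> multiples.\<close>
    define f where "f = (\<lambda>((x, y, z), r). (r * (x - x0), r * (y - y0), r * (z - z0)))"
    let ?D = "(K - {(x0, y0, z0)}) \<times> (UNIV - {0 :: 'a})"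
    have secant: "l (x - x0, y - y0, z - z0) = Q (x - x0, y - y0, z - z0)" if "(x, y, z) \<in> K" for x y z
    proof -
      have "l (x - x0, y - y0, z - z0) - Q (x - x0, y - y0, z - z0) =
          (x * (t - x) - y * z) - (x0 * (t - x0) - y0 * z0)"
        by (simp add: l_def Q_def power2_eq_square algebra_simps)
      then show ?thesis
        using that P0 by (simp add: K_def)
    qed
    have l_scale: "l (r * x, r * y, r * z) = r * l (x, y, z)"
      and Q_scale: "Q (r * x, r * y, r * z) = r\<^sup>2 * Q (x, y, z)" for r x y z
      by (simp_all add: l_def Q_def power2_eq_square algebra_simps)
    have plane: "\<alpha> * (r * (x - x0)) + \<beta> * (r * (y - y0)) + \<gamma> * (r * (z - z0)) = 0" if "(x, y, z) \<in> K" for r x y z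
    proof -
      have "\<alpha> * (r * (x - x0)) + \<beta> * (r * (y - y0)) + \<gamma> * (r * (z - z0)) =
          r * ((\<alpha> * x + \<beta> * y + \<gamma> * z) - (\<alpha> * x0 + \<beta> * y0 + \<gamma> * z0))"
        by (simp add: algebra_simps)
      then show ?thesis
        using that P0 by (simp add: K_def)
    qed
    have f_X: "f ((x, y, z), r) \<in> X" if "(x, y, z) \<in> K" "(x, y, z) \<noteq> (x0, y0, z0)" "r \<noteq> 0" for x y z r
    proof -
      have in_M: "(s * (x - x0), s * (y - y0), s * (z - z0)) \<in> M" if "s \<noteq> 0" for s
        using that \<open>(x, y, z) \<noteq> (x0, y0, z0)\<close> plane[OF \<open>(x, y, z) \<in> K\<close>, of s] by (auto simp: M_def)
      have "l (x - x0, y - y0, z - z0) \<noteq> 0"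
      proof
        assume "l (x - x0, y - y0, z - z0) = 0"
        then have "(x - x0, y - y0, z - z0) \<in> I \<inter> T"
          using secant[OF \<open>(x, y, z) \<in> K\<close>] in_M[of 1] by (simp add: I T_def)
        then show False
          using disjoint by blast
      qed
      then show ?thesis
        using in_M[OF \<open>r \<noteq> 0\<close>] secant[OF \<open>(x, y, z) \<in> K\<close>] \<open>r \<noteq> 0\<close>
        by (simp add: X_def f_def l_scale Q_scale)
    qed
    have f_inv: "(x, y, z) = (x0 + s * u, y0 + s * v, z0 + s * w) \<and> r = 1 / s"
      if "f ((x, y, z), r) = (u, v, w)" "s = l (u, v, w) / Q (u, v, w)"
        "(x, y, z) \<in> K" "(x, y, z) \<noteq> (x0, y0, z0)" "r \<noteq> 0" for x y z r u v w s
    proof -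
      have uvw: "u = r * (x - x0)" "v = r * (y - y0)" "w = r * (z - z0)"
        using that(1) by (auto simp: f_def)
      have "Q (u, v, w) \<noteq> 0"
        using f_X[OF that(3-5)] that(1) by (simp add: X_def)
      moreover have "Q (u, v, w) = r * l (u, v, w)"
        unfolding uvw l_scale Q_scale secant[OF that(3)] by (simp add: power2_eq_square)
      ultimately have "s = 1 / r"
        using that(2) by auto
      then show ?thesis
        using that(5) by (simp add: uvw)
    qed
    have inj: "inj_on f ?D"
    proof (rule inj_onI)
      fix a b assume a: "a \<in> ?D" and b: "b \<in> ?D" and eq: "f a = f b"
      obtain x y z r where a': "a = ((x, y, z), r)"
        by (metis surj_pair)
      obtain x' y' z' r' where b': "b = ((x', y', z'), r')"
        by (metis surj_pair)
      obtain u v w where uvw: "f a = (u, v, w)"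
        by (metis surj_pair)
      have "(x, y, z) = (x', y', z') \<and> r = r'"
        using f_inv[of x y z r u v w, OF _ refl] f_inv[of x' y' z' r' u v w, OF _ refl]
          a b eq uvw unfolding a' b' by auto
      then show "a = b"
        by (simp add: a' b')
    qed
    have "f ` ?D \<subseteq> X"
      by (rule image_subsetI) (use f_X in \<open>auto simp del: prod.inject\<close>)
    then have DX: "card ?D \<le> card X"
      by (rule card_inj_on_le[OF inj]) simp
    have "card X + card I + card T = card (X \<union> I \<union> T)"
      using disjoint by (subst card_Un_disjoint; (subst card_Un_disjoint)?) (auto simp: X_def I T_def)
    also have "\<dots> \<le> card M"
      by (rule card_mono) (auto simp: X_def I T_def)
    finally have XIT: "card X + card I + card T \<le> card M" .
    have K: "card K = Suc (card (K - {(x0, y0, z0)}))"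
      using \<open>(x0, y0, z0) \<in> K\<close> by (intro card.remove) auto
    have "card (UNIV - {0::'a}) = ?q - 1"
      by (rule card_Diff_singleton) simp
    then have "card ?D = card (K - {(x0, y0, z0)}) * (?q - 1)"
      by (simp only: card_cartesian_product)
    then have "(?q - 1) * card K = card ?D + (?q - 1)"
      unfolding K by (simp only: mult_Suc_right mult.commute add.commute)
    then show ?thesis
      using DX XIT M T by linarith
  qed
qed

section \<open>The second moment of the number of s with prescribed trace\<close>

lemma matrix_eq_2: "A = B \<longleftrightarrow> A$1$1 = B$1$1 \<and> A$1$2 = B$1$2 \<and> A$2$1 = B$2$1 \<and> A$2$2 = B$2$2"
  for A B :: "'a ^ 2 ^ 2"
  by (auto simp: vec_eq_iff forall_2)

lemma vec_eq_2: "u = v \<longleftrightarrow> u$1 = v$1 \<and> u$2 = v$2"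
  for u v :: "'a ^ 2"
  by (auto simp: vec_eq_iff forall_2)

lemma trace_2: "trace A = A$1$1 + A$2$2"
  for A :: "'a::comm_ring_1 ^ 2 ^ 2"
  by (simp add: trace_def sum_2)

lemma trace_mult_2:
  "trace (A ** B) = A$1$1 * B$1$1 + A$1$2 * B$2$1 + A$2$1 * B$1$2 + A$2$2 * B$2$2"
  for A B :: "'a::comm_ring_1 ^ 2 ^ 2"
  by (simp add: trace_2 matrix_matrix_mult_def sum_2)

text \<open>
  For scalar \<open>A \<noteq> 1\<close> the two trace conditions contradict each other. Otherwise they cut out a conic
  as in \<open>card_conic_bound\<close>. The isotropic directions are nilpotent matrices \<open>m\<close> with
  \<open>trace (m ** A) = 0\<close>, and this means that the kernel of \<open>m\<close> is an eigenline of \<open>A\<close>. So the points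
  at infinity of the conic correspond to the eigenlines of \<open>A\<close>.
\<close>

lemma card_trace_trace_bound:
  fixes A :: "'a::{field,finite} ^ 2 ^ 2"
  assumes nonsquare: "\<nexists>y. y\<^sup>2 = t\<^sup>2 - 4 * d" and "t \<noteq> 0"
    and A: "det A = 1" "A \<noteq> mat 1"
  shows "(CARD('a) - 1) * card {h. det h = d \<and> trace h = t \<and> trace (h ** A) = t} +
    card {u \<in> nonzero_vectors. \<exists>r. A *v u = r *s u} \<le> CARD('a)\<^sup>2 - 1"
    (is "_ * card ?K + card ?E \<le> _")
proof (cases "(A$1$1 - A$2$2, A$2$1, A$1$2) = (0, 0, 0)")
  case True
  have "A$1$1 \<noteq> 1"
    using True A by (auto simp: matrix_eq_2 mat_def)
  have "trace (h ** A) = A$1$1 * trace h" for h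
    using True by (simp add: trace_mult_2 trace_2[of h] algebra_simps)
  then have "?K = {}"
    using \<open>A$1$1 \<noteq> 1\<close> \<open>t \<noteq> 0\<close> by auto
  moreover have "card ?E \<le> card (nonzero_vectors :: ('a ^ 2) set)"
    by (rule card_mono) auto
  ultimately show ?thesis
    unfolding card_nonzero_vectors by (simp only: card.empty)
next
  case False
  let ?\<alpha> = "A$1$1 - A$2$2" and ?\<beta> = "A$2$1" and ?\<gamma> = "A$1$2"
  let ?C = "{(x, y, z). x * (t - x) - y * z = d \<and> ?\<alpha> * x + ?\<beta> * y + ?\<gamma> * z = t - t * A$2$2}"
  let ?I = "{(x, y, z). (x, y, z) \<noteq> (0, 0, 0) \<and> ?\<alpha> * x + ?\<beta> * y + ?\<gamma> * z = 0 \<and> x\<^sup>2 + y * z = 0}"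
  have "card ?K \<le> card ?C"
  proof (rule card_inj_on_le[where f = "\<lambda>h. (h$1$1, h$1$2, h$2$1)"])
    show "inj_on (\<lambda>h. (h$1$1, h$1$2, h$2$1)) ?K"
      by (auto simp: inj_on_def matrix_eq_2 trace_2)
    have "(h$1$1, h$1$2, h$2$1) \<in> ?C" if h: "det h = d" "trace h = t" "trace (h ** A) = t" for h
    proof -
      have h22: "h$2$2 = t - h$1$1"
        using h(2) by (simp add: trace_2 algebra_simps)
      show ?thesis
        using h(1,3) by (simp add: det_2 trace_mult_2 h22 algebra_simps)
    qed
    then show "(\<lambda>h. (h$1$1, h$1$2, h$2$1)) ` ?K \<subseteq> ?C"
      by blast
  qed simp
  moreover have "card ?E \<le> card ?I"
  proof -
    \<comment> \<open>The nilpotent matrix with kernel and image spanned by \<open>u\<close>, scaled such that distinct multiples of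
      \<open>u\<close> give distinct matrices.\<close>
    define f :: "'a ^ 2 \<Rightarrow> 'a \<times> 'a \<times> 'a"
      where "f = (\<lambda>u. if u$1 = 0 then (0, 0, - u$2) else (- u$2, u$1, - (u$2)\<^sup>2 / u$1))"
    have "inj_on f ?E"
      by (auto simp: inj_on_def f_def vec_eq_2 split: if_splits)
    moreover have f_I: "f u \<in> ?I" if u: "u \<noteq> 0" "A *v u = r *s u" for u r
    proof -
      have e: "A$1$1 * u$1 + A$1$2 * u$2 = r * u$1" "A$2$1 * u$1 + A$2$2 * u$2 = r * u$2"
        using u(2) matrix_vector_mult_2[of A u] by simp_all
      then have parallel: "(A$1$1 * u$1 + A$1$2 * u$2) * u$2 = (A$2$1 * u$1 + A$2$2 * u$2) * u$1"
        by simp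
      show ?thesis
      proof (cases "u$1 = 0")
        case True
        then show ?thesis
          using u(1) parallel by (auto simp: f_def vec_eq_2)
      next
        case False
        have "?\<alpha> * - u$2 + ?\<beta> * u$1 + ?\<gamma> * (- (u$2)\<^sup>2 / u$1) = 0"
          using parallel False by (simp add: field_simps power2_eq_square)
        then show ?thesis
          using False by (simp add: f_def)
      qed
    qed
    have "f ` ?E \<subseteq> ?I"
    proof (rule image_subsetI)
      fix u assume "u \<in> ?E"
      then obtain r where "u \<noteq> 0" "A *v u = r *s u"
        by (auto simp: nonzero_vectors_def)
      then show "f u \<in> ?I"
        by (rule f_I)
    qed
    ultimately show ?thesis
      by (intro card_inj_on_le) auto
  qed
  ultimately have "(CARD('a) - 1) * card ?K + card ?E \<le> (CARD('a) - 1) * card ?C + card ?I"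
    by (intro add_mono mult_le_mono) auto
  then show ?thesis
    using card_conic_bound[OF nonsquare False, of "t - t * A$2$2"] by linarith
qed

text \<open>
  For fixed \<open>u\<close> and each nonzero \<open>r\<close>, exactly one \<open>A\<close> in \<open>S\<close> maps \<open>u\<close> to \<open>r *s (s *v u)\<close>. So the
  total number of eigenlines of all quotients of \<open>s\<close> and \<open>A\<close> is known exactly.
\<close>

lemma sum_card_parallel:
  fixes S :: "('a::{field,finite} ^ 2 ^ 2) set"
  assumes sharp: "sharply_transitive_on (*v) nonzero_vectors S" "\<forall>A\<in>S. det A \<noteq> 0" and s: "det s \<noteq> 0"
  shows "(\<Sum>A\<in>S. card {u \<in> nonzero_vectors. \<exists>r. A *v u = r *s (s *v u)}) =
    (CARD('a) - 1) * (CARD('a)\<^sup>2 - 1)"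
proof -
  have "card {A \<in> S. \<exists>r. A *v u = r *s (s *v u)} = CARD('a) - 1" if "u \<in> nonzero_vectors" for u
  proof -
    have u: "u \<noteq> 0"
      using that by (simp add: nonzero_vectors_def)
    have su: "s *v u \<noteq> 0"
      by (rule matrix_vector_mult_nonzero[OF s u])
    let ?W = "(\<lambda>r. r *s (s *v u)) ` (UNIV - {0})"
    have bij: "bij_betw (\<lambda>A. A *v u) S nonzero_vectors"
      by (rule sharply_transitive_bij_betw[OF sharp u])
    have "card {A \<in> S. \<exists>r. A *v u = r *s (s *v u)} = card ?W"
    proof (rule bij_betw_same_card[OF bij_betw_subset[OF bij]])
      have "A *v u \<noteq> 0" if "A \<in> S" for A
        using that sharp(2) matrix_vector_mult_nonzero[OF _ u] by blast
      moreover have "r *s (s *v u) \<in> (\<lambda>A. A *v u) ` S" if "r \<noteq> 0" for r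
        using bij_betw_imp_surj_on[OF bij] su that by (auto simp: nonzero_vectors_def)
      ultimately show "(\<lambda>A. A *v u) ` {A \<in> S. \<exists>r. A *v u = r *s (s *v u)} = ?W"
      proof (intro equalityI subsetI)
        fix v assume "v \<in> (\<lambda>A. A *v u) ` {A \<in> S. \<exists>r. A *v u = r *s (s *v u)}"
        then obtain A r where "A \<in> S" "v = A *v u" "A *v u = r *s (s *v u)"
          by blast
        moreover from this have "r \<noteq> 0"
          using \<open>\<And>A. A \<in> S \<Longrightarrow> A *v u \<noteq> 0\<close> by (metis vector_smult_lzero)
        ultimately show "v \<in> ?W"
          by blast
      next
        fix v assume "v \<in> ?W"
        then obtain r where "r \<noteq> 0" "v = r *s (s *v u)"
          by blast
        moreover from this obtain A where "A \<in> S" "r *s (s *v u) = A *v u"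
          using \<open>\<And>r. r \<noteq> 0 \<Longrightarrow> r *s (s *v u) \<in> (\<lambda>A. A *v u) ` S\<close> by blast
        ultimately show "v \<in> (\<lambda>A. A *v u) ` {A \<in> S. \<exists>r. A *v u = r *s (s *v u)}"
          by (metis (mono_tags, lifting) image_eqI mem_Collect_eq)
      qed
    qed auto
    moreover have "inj_on (\<lambda>r. r *s (s *v u)) (UNIV - {0})"
      using su by (auto simp: inj_on_def vec_eq_2)
    ultimately show ?thesis
      by (simp add: card_image card_Diff_singleton)
  qed
  then show ?thesis
    using sum_multicount[of S nonzero_vectors "\<lambda>A u. \<exists>r. A *v u = r *s (s *v u)" "CARD('a) - 1"]
    by (simp add: card_nonzero_vectors)
qed

lemma card_trace_eq_translate:
  fixes s B :: "'a::{field,finite} ^ 2 ^ 2"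
  assumes "det s = 1" and "s ** B = mat 1" "B ** s = mat 1"
  shows "card {h. det h = d \<and> trace (h ** s) = c \<and> P (h ** s)} = card {h. det h = d \<and> trace h = c \<and> P h}"
proof -
  have hB: "(h ** B) ** s = h" and hs: "(h ** s) ** B = h" for h
    using assms by (metis matrix_mul_assoc matrix_mul_rid)+
  have "det B = 1"
    using assms by (metis det_I det_mul mult_1)
  then have "bij_betw (\<lambda>h. h ** s) {h. det h = d \<and> trace (h ** s) = c \<and> P (h ** s)} {h. det h = d \<and> trace h = c \<and> P h}"
    using assms(1) by (intro bij_betwI[where g = "\<lambda>h. h ** B"]) (auto simp: det_mul hB hs)
  then show ?thesis
    by (rule bij_betw_same_card)
qed

text \<open>
  For \<open>t \<noteq> s\<close> the summand is at most \<open>q + 1\<close> minus the number of eigenlines of the quotient of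
  \<open>s\<close> and \<open>t\<close>, as this quotient is not the identity. The eigenlines are summed by \<open>sum_card_parallel\<close>. The
  summand for \<open>t = s\<close> is the number of matrices with the given determinant and trace; there all
  \<open>q + 1\<close> lines are eigenlines, so it fits into the same sum.
\<close>

lemma card_second_moment_row:
  fixes S :: "('a::{field,finite} ^ 2 ^ 2) set"
  assumes nonsquare: "\<nexists>y. y\<^sup>2 = c\<^sup>2 - 4 * d" and "c \<noteq> 0"
    and S: "S \<subseteq> SL2" "sharply_transitive_on (*v) nonzero_vectors S" and s: "s \<in> S"
  shows "(\<Sum>t\<in>S. card {h. det h = d \<and> trace (h ** s) = c \<and> trace (h ** t) = c}) + (CARD('a)\<^sup>2 - 1)
    \<le> card {h :: 'a ^ 2 ^ 2. det h = d \<and> trace h = c} + (CARD('a) + 1) * (CARD('a)\<^sup>2 - 1)"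
    (is "?sum + _ \<le> ?G + _")
proof -
  let ?q = "CARD('a)"
  let ?K = "\<lambda>t. card {h. det h = d \<and> trace (h ** s) = c \<and> trace (h ** t) = c}"
  let ?e = "\<lambda>t. card {u \<in> nonzero_vectors. \<exists>r. t *v u = r *s (s *v u)}"
  have det: "\<forall>A\<in>S. det A \<noteq> 0" "det s = 1"
    using S(1) s by (auto simp: SL2_def)
  then have "invertible s"
    by (simp add: invertible_det_nz)
  then obtain B where B: "s ** B = mat 1" "B ** s = mat 1"
    unfolding invertible_def by blast
  have detB: "det B = 1"
    using det(2) B by (metis det_I det_mul mult_1)
  have es: "?e s = ?q\<^sup>2 - 1"
  proof -
    have "\<exists>r. v = r *s v" for v :: "'a ^ 2"
      by (metis vector_smult_lid)
    then show ?thesis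
      by (simp add: card_nonzero_vectors)
  qed
  have Ks: "?K s = ?G"
    using card_trace_eq_translate[OF det(2) B, of d c "\<lambda>_. True"] by simp
  have off_diagonal: "(?q - 1) * ?K t + ?e t \<le> ?q\<^sup>2 - 1" if t: "t \<in> S" "t \<noteq> s" for t
  proof -
    have "trace (h ** t) = trace ((h ** s) ** (B ** t))" for h
      by (metis B(1) matrix_mul_assoc matrix_mul_lid)
    then have K: "?K t = card {h. det h = d \<and> trace h = c \<and> trace (h ** (B ** t)) = c}"
      using card_trace_eq_translate[OF det(2) B, of d c "\<lambda>h. trace (h ** (B ** t)) = c"] by simp
    have "t *v u = r *s (s *v u) \<longleftrightarrow> (B ** t) *v u = r *s u" for u r
    proof
      assume "t *v u = r *s (s *v u)"
      then have "B *v (t *v u) = r *s (B *v (s *v u))"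
        by (simp add: vector_scalar_commute)
      then show "(B ** t) *v u = r *s u"
        by (simp add: matrix_vector_mul_assoc B)
    next
      assume "(B ** t) *v u = r *s u"
      then have "s *v ((B ** t) *v u) = r *s (s *v u)"
        by (simp add: vector_scalar_commute)
      then show "t *v u = r *s (s *v u)"
        by (simp add: matrix_vector_mul_assoc matrix_mul_assoc B)
    qed
    then have e: "?e t = card {u \<in> nonzero_vectors. \<exists>r. (B ** t) *v u = r *s u}"
      by simp
    have "det (B ** t) = 1"
      using t S(1) detB by (auto simp: det_mul SL2_def)
    moreover have "B ** t \<noteq> mat 1"
      using t(2) B by (metis matrix_mul_assoc matrix_mul_lid matrix_mul_rid)
    ultimately show ?thesis
      unfolding K e using assms by (intro card_trace_trace_bound) auto
  qed
  have q: "?q > 1"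
    using card_mono[of UNIV "{0, 1 :: 'a}"] by simp
  have q2: "?q\<^sup>2 - 1 = (?q - 1) * (?q + 1)"
    using q by (cases ?q) (auto simp: power2_eq_square algebra_simps)
  have "(?q - 1) * (?sum + (?q\<^sup>2 - 1)) = (\<Sum>t\<in>S. (?q - 1) * ?K t + ?e t)"
    using sum_card_parallel[OF S(2) det(1), of s] det(2)
    by (simp only: sum.distrib sum_distrib_left[symmetric] distrib_left) simp
  also have "\<dots> = ((?q - 1) * ?K s + ?e s) + (\<Sum>t\<in>S - {s}. (?q - 1) * ?K t + ?e t)"
    by (rule sum.remove) (use s in auto)
  also have "\<dots> \<le> ((?q - 1) * ?G + (?q\<^sup>2 - 1)) + (\<Sum>t\<in>S - {s}. ?q\<^sup>2 - 1)"
    unfolding Ks es by (intro add_left_mono sum_mono) (use off_diagonal in auto)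
  also have "\<dots> = (?q - 1) * ?G + card S * (?q\<^sup>2 - 1)"
  proof -
    have "card S = Suc (card (S - {s}))"
      using s by (intro card.remove) auto
    then show ?thesis
      by (simp only: sum_constant of_nat_id mult_Suc add.assoc)
  qed
  also have "\<dots> = (?q - 1) * (?G + (?q + 1) * (?q\<^sup>2 - 1))"
  proof -
    have "(?q - 1) * ((?q + 1) * (?q\<^sup>2 - 1)) = (?q\<^sup>2 - 1) * (?q\<^sup>2 - 1)"
      by (simp only: mult.assoc[symmetric] q2[symmetric])
    then show ?thesis
      by (simp only: card_sharply_transitive[OF S(2) det(1)] add_mult_distrib2)
  qed
  finally show ?thesis
    using q by simp
qed

text \<open>
  Given a nonzero first column, one entry of the second column determines the other.
\<close>

lemma card_det_le:
  assumes "d \<noteq> (0::'a::{field,finite})"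
  shows "card {h :: 'a ^ 2 ^ 2. det h = d} \<le> CARD('a) * (CARD('a)\<^sup>2 - 1)"
proof -
  let ?f = "\<lambda>h :: 'a ^ 2 ^ 2. (column 1 h, if h$1$1 = 0 then h$2$2 else h$1$2)"
  have "inj_on ?f {h. det h = d}"
  proof (rule inj_onI)
    fix g h :: "'a ^ 2 ^ 2"
    assume g: "g \<in> {h. det h = d}" and h: "h \<in> {h. det h = d}" and eq: "?f g = ?f h"
    have c: "g$1$1 = h$1$1" "g$2$1 = h$2$1"
      using eq by (auto simp: column_def vec_eq_2)
    show "g = h"
    proof (cases "h$1$1 = 0")
      case True
      then have "g$2$2 = h$2$2" "g$1$2 * h$2$1 = h$1$2 * h$2$1" "h$2$1 \<noteq> 0"
        using g h eq c assms by (auto simp: det_2)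
      then show ?thesis
        using c by (simp add: matrix_eq_2)
    next
      case False
      then have "g$1$2 = h$1$2" "h$1$1 * g$2$2 = h$1$1 * h$2$2"
        using g h eq c by (auto simp: det_2 algebra_simps)
      then show ?thesis
        using c False by (simp add: matrix_eq_2)
    qed
  qed
  moreover have "?f ` {h. det h = d} \<subseteq> nonzero_vectors \<times> UNIV"
    using assms by (auto simp: nonzero_vectors_def column_def vec_eq_2 det_2)
  ultimately have "card {h :: 'a ^ 2 ^ 2. det h = d} \<le> card ((nonzero_vectors :: ('a ^ 2) set) \<times> (UNIV :: 'a set))"
    by (rule card_inj_on_le) simp
  then show ?thesis
    by (simp add: card_cartesian_product card_nonzero_vectors mult.commute)
qed

lemma card_det_trace_ge:
  fixes d t :: "'a::{field,finite}"
  shows "CARD('a) * (CARD('a) - 1) \<le> card {h :: 'a ^ 2 ^ 2. det h = d \<and> trace h = t}"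
proof -
  let ?f = "\<lambda>(x, y). vector [vector [x, y], vector [(x * (t - x) - d) / y, t - x]] :: 'a ^ 2 ^ 2"
  have "inj_on ?f (UNIV \<times> (UNIV - {0}))"
    by (auto simp: inj_on_def matrix_eq_2)
  moreover have "?f ` (UNIV \<times> (UNIV - {0})) \<subseteq> {h. det h = d \<and> trace h = t}"
    by (auto simp: det_2 trace_2)
  ultimately have "card ((UNIV :: 'a set) \<times> (UNIV - {0 :: 'a})) \<le> card {h :: 'a ^ 2 ^ 2. det h = d \<and> trace h = t}"
    by (rule card_inj_on_le) simp
  then show ?thesis
    by (simp add: card_cartesian_product card_Diff_singleton)
qed

lemma sum_card_power2:
  assumes "finite G" "finite S"
  shows "(\<Sum>h\<in>G. (card {s \<in> S. R h s})\<^sup>2) = (\<Sum>s\<in>S. \<Sum>t\<in>S. card {h \<in> G. R h s \<and> R h t})"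
proof -
  have card: "card {x \<in> A. P x} = (\<Sum>x\<in>A. if P x then 1 else 0)" if "finite A" for A :: "'c set" and P
    using that by (simp add: sum.If_cases Int_def)
  have "(\<Sum>h\<in>G. (card {s \<in> S. R h s})\<^sup>2) = (\<Sum>h\<in>G. \<Sum>s\<in>S. \<Sum>t\<in>S. if R h s \<and> R h t then 1 else 0)"
    using assms by (auto simp: card power2_eq_square sum_product intro!: sum.cong)
  also have "\<dots> = (\<Sum>s\<in>S. \<Sum>t\<in>S. \<Sum>h\<in>G. if R h s \<and> R h t then 1 else 0)"
    by (subst sum.swap) (rule sum.cong[OF refl], rule sum.swap)
  also have "\<dots> = (\<Sum>s\<in>S. \<Sum>t\<in>S. card {h \<in> G. R h s \<and> R h t})"
    using assms by (simp add: card)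
  finally show ?thesis .
qed

section \<open>Nonsquares of the form \<open>k\<^sup>2 - 4\<close>\<close>

text \<open>
  The bound \<open>k (q - k) > 3 q - 3\<close> holds for \<open>4 \<le> k \<le> q - 4\<close>, with equality instead for
  \<open>q = 13\<close> and \<open>k \<in> {4, 9}\<close>. Let \<open>N\<close> be the least natural number that is not a square in the field.
  If \<open>N \<ge> 6\<close>, then \<open>k = N - 2\<close> works, as \<open>k\<^sup>2 - 4 = (N - 4) N\<close> with \<open>N - 4\<close> a nonzero square. For
  \<open>N = 2, 3, 5\<close> the choices \<open>k = 6, 4, 7\<close> give \<open>k\<^sup>2 - 4 = 16 N, 4 N, 9 N\<close>. For \<open>q = 13\<close> only
  \<open>N = 2\<close> is possible.
\<close>

lemma exists_nonsquare_discriminant: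
  assumes prime: "prime CARD('a::{field,finite})" and "13 \<le> CARD('a)"
  obtains k where "4 \<le> k" "k + 4 \<le> CARD('a)" "3 * CARD('a) < k * (CARD('a) - k) + 3"
    "\<nexists>y. y\<^sup>2 = (of_nat k)\<^sup>2 - (4 :: 'a)"
proof -
  let ?q = "CARD('a)"
  define sq where "sq a \<longleftrightarrow> (\<exists>y. y\<^sup>2 = a)" for a :: 'a
  have of_nat_zero_iff: "of_nat n = (0::'a) \<longleftrightarrow> ?q dvd n" for n
    using of_nat_eq_0_iff_char_dvd[where 'a='a, of n] CHAR_eq_card[OF prime] by simp
  have of_nat_nz: "of_nat n \<noteq> (0::'a)" if "0 < n" "n < ?q" for n
    using that of_nat_zero_iff by (auto dest: dvd_imp_le)
  have small: "(2::'a) \<noteq> 0" "(3::'a) \<noteq> 0" "(4::'a) \<noteq> 0"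
    using of_nat_nz[of 2] of_nat_nz[of 3] of_nat_nz[of 4] assms(2) by simp_all
  have sq_mult: "sq (a * b) \<longleftrightarrow> sq b" if "sq a" "a \<noteq> 0" for a b
  proof -
    obtain y where y: "y\<^sup>2 = a"
      using \<open>sq a\<close> by (auto simp: sq_def)
    show ?thesis
    proof
      assume "sq (a * b)"
      then obtain z where "z\<^sup>2 = a * b"
        by (auto simp: sq_def)
      then have "(z / y)\<^sup>2 = b"
        using y \<open>a \<noteq> 0\<close> by (simp add: power_divide)
      then show "sq b"
        by (auto simp: sq_def)
    next
      assume "sq b"
      then obtain z where "z\<^sup>2 = b"
        by (auto simp: sq_def)
      then have "(y * z)\<^sup>2 = a * b"
        using y by (simp add: power_mult_distrib)
      then show "sq (a * b)"
        by (auto simp: sq_def)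
    qed
  qed
  have sq_square: "sq (a\<^sup>2)" for a
    by (auto simp: sq_def)
  have "\<exists>n<?q. of_nat n = a" for a :: 'a
  proof -
    have "inj_on (of_nat :: nat \<Rightarrow> 'a) {..<?q}"
    proof (rule linorder_inj_onI)
      fix m n assume "m < n" "m \<in> {..<?q}" "n \<in> {..<?q}"
      then have "of_nat (n - m) \<noteq> (0::'a)"
        by (intro of_nat_nz) auto
      then show "of_nat m \<noteq> (of_nat n :: 'a)"
        using \<open>m < n\<close> by (simp add: of_nat_diff)
    qed auto
    then have "(of_nat :: nat \<Rightarrow> 'a) ` {..<?q} = UNIV"
      by (intro card_subset_eq) (auto simp: card_image)
    then show ?thesis
      by (metis UNIV_I imageE lessThan_iff)
  qed
  moreover obtain a :: 'a where "\<not> sq a"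
  proof -
    have "\<not> inj (\<lambda>y::'a. y\<^sup>2)"
      using injD[of "\<lambda>y::'a. y\<^sup>2" 1 "-1"] small(1) by (auto simp: eq_neg_iff_add_eq_0)
    then have "\<not> surj (\<lambda>y::'a. y\<^sup>2)"
      using finite_UNIV_surj_inj[of "\<lambda>y::'a. y\<^sup>2"] by auto
    then show thesis
      using that unfolding sq_def surj_def by metis
  qed
  ultimately have ex: "\<exists>n. \<not> sq (of_nat n) \<and> n < ?q"
    by metis
  define N where "N = (LEAST n. \<not> sq (of_nat n) \<and> n < ?q)"
  have N: "\<not> sq (of_nat N)" "N < ?q"
    using LeastI_ex[OF ex] unfolding N_def by auto
  have least: "sq (of_nat n)" if "n < N" for n
    using not_less_Least[of n "\<lambda>n. \<not> sq (of_nat n) \<and> n < ?q"] that N(2) unfolding N_def by auto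
  have "sq 0" "sq 1" "sq 4"
    using sq_square[of 0] sq_square[of 1] sq_square[of 2] by simp_all
  then have "N \<noteq> 0" "N \<noteq> 1" and N4: "N \<noteq> 4"
    using N(1) by (metis of_nat_0, metis of_nat_1, metis of_nat_numeral)
  then have N2: "N \<ge> 2"
    by linarith
  \<comment> \<open>If \<open>2 = y\<^sup>2\<close> modulo 13, then \<open>1 = y ^ 12 = 2 ^ 6 = 64\<close>, but 13 does not divide 63.\<close>
  have N13: "N = 2" if "?q = 13"
  proof (rule ccontr)
    assume "N \<noteq> 2"
    then have "sq 2"
      using least[of 2] N2 by simp
    then obtain y :: 'a where y: "y\<^sup>2 = 2"
      by (auto simp: sq_def)
    then have "y \<noteq> 0"
      using small by auto
    then have "y ^ 12 = 1"
      using power_card_minus_1[of y] that by simp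
    moreover have "y ^ 12 = 64"
      using power_mult[of y 2 6] y by simp
    moreover have "of_nat 63 = (64 - 1 :: 'a)"
      by simp
    ultimately have "of_nat 63 = (0::'a)"
      by simp
    then show False
      unfolding of_nat_zero_iff that by simp
  qed
  \<comment> \<open>If \<open>-1\<close> is not a square but 2 is, then \<open>q - 2\<close>, which is \<open>2 * (-1)\<close> in the field, is a smaller
    nonsquare than \<open>q - 1\<close>.\<close>
  have N_le: "N + 2 \<le> ?q" if "N > 2"
  proof (rule ccontr)
    assume "\<not> N + 2 \<le> ?q"
    then have "N + 1 = ?q"
      using N(2) by linarith
    then have "of_nat (N + 1) = (0::'a)"
      unfolding of_nat_zero_iff by simp
    then have "of_nat N + 1 = (0::'a)"
      by (simp only: of_nat_add of_nat_1)
    moreover have "of_nat (N - 1) = (of_nat N - 1 :: 'a)"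
      using that by (simp add: of_nat_diff)
    ultimately have "of_nat (N - 1) = (2 * of_nat N :: 'a)"
      by (simp add: add_eq_0_iff2)
    moreover have "sq (of_nat (N - 1))" "sq (of_nat 2)"
      using that by (intro least; simp)+
    ultimately show False
      using sq_mult[of 2 "of_nat N"] N(1) small(1) by (metis of_nat_numeral)
  qed
  have scaled: "\<not> sq (a\<^sup>2 * of_nat N)" if "a \<noteq> 0" for a
    using sq_mult[OF sq_square] N(1) that by simp
  consider "N = 2" | "N = 3" | "N = 5" | "N \<ge> 6"
    using N2 N4 by linarith
  then show thesis
  proof cases
    case 1
    have "(of_nat 6)\<^sup>2 - 4 = 4\<^sup>2 * (of_nat N :: 'a)"
      by (simp add: 1)
    then have "\<not> sq ((of_nat 6)\<^sup>2 - 4)"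
      using scaled small by metis
    then show thesis
      using assms(2) by (intro that[of 6]) (auto simp: sq_def)
  next
    case 2
    have "(of_nat 4)\<^sup>2 - 4 = 2\<^sup>2 * (of_nat N :: 'a)"
      by (simp add: 2)
    then have "\<not> sq ((of_nat 4)\<^sup>2 - 4)"
      using scaled small by metis
    moreover have "?q \<noteq> 13"
      using N13 2 by auto
    ultimately show thesis
      using assms(2) by (intro that[of 4]) (auto simp: sq_def)
  next
    case 3
    have "(of_nat 7)\<^sup>2 - 4 = 3\<^sup>2 * (of_nat N :: 'a)"
      by (simp add: 3)
    then have "\<not> sq ((of_nat 7)\<^sup>2 - 4)"
      using scaled small by metis
    then show thesis
      using assms(2) by (intro that[of 7]) (auto simp: sq_def)
  next
    case 4
    have "sq (of_nat (N - 4))" "of_nat (N - 4) \<noteq> (0::'a)"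
      using least[of "N - 4"] of_nat_nz[of "N - 4"] N(2) 4 by auto
    then have "\<not> sq (of_nat (N - 4) * of_nat N)"
      using sq_mult N(1) by blast
    also have "of_nat (N - 4) * of_nat N = (of_nat (N - 2))\<^sup>2 - (4::'a)"
      using 4 by (simp add: of_nat_diff power2_eq_square algebra_simps)
    finally have "\<not> sq ((of_nat (N - 2))\<^sup>2 - 4)" .
    moreover have "3 * ?q < (N - 2) * (?q - (N - 2)) + 3"
    proof -
      have "?q > 13"
        using N13 4 assms(2) by fastforce
      obtain a where a: "N = 6 + a"
        using le_Suc_ex[OF 4] by blast
      have "N + 2 \<le> ?q"
        using N_le 4 by simp
      then obtain b where b: "?q = N + 2 + b"
        using le_Suc_ex by blast
      have "13 < a + b + 8"
        using \<open>?q > 13\<close> a b by simp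
      then show ?thesis
        unfolding b unfolding a by (simp add: algebra_simps)
    qed
    ultimately show thesis
      using N_le 4 by (intro that[of "N - 2"]) (auto simp: sq_def)
  qed
qed

section \<open>The second moment against the residue\<close>

text \<open>
  Left multiplication by \<open>h\<close> turns \<open>S\<close> into a sharply transitive set of matrices of determinant
  \<open>d\<close>.
\<close>

lemma card_trace_product_mod:
  fixes S :: "('a::{field,finite} ^ 2 ^ 2) set"
  assumes prime: "prime CARD('a)" and odd: "odd CARD('a)"
    and S: "S \<subseteq> SL2" "sharply_transitive_on (*v) nonzero_vectors S"
    and h: "det h = d" and "d \<noteq> 0" and nonsquare: "\<nexists>y. y\<^sup>2 = c\<^sup>2 - 4 * d"
  shows "of_nat (card {s \<in> S. trace (h ** s) = c}) = c\<^sup>2 / d - 3"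
proof -
  have "invertible h"
    using h \<open>d \<noteq> 0\<close> by (simp add: invertible_det_nz)
  then obtain B where B: "h ** B = mat 1" "B ** h = mat 1"
    unfolding invertible_def by blast
  have "inj (\<lambda>s. h ** s)"
    by (rule injI) (metis B(2) matrix_mul_assoc matrix_mul_lid)
  then have inj: "inj_on (\<lambda>s. h ** s) A" for A
    by (rule inj_on_subset) simp
  let ?T = "(\<lambda>s. h ** s) ` S"
  have det: "\<forall>A\<in>?T. det A = d"
    using S(1) h by (auto simp: det_mul SL2_def)
  have sharp: "sharply_transitive_on (*v) nonzero_vectors ?T"
    unfolding sharply_transitive_on_def
  proof (intro ballI)
    fix u v :: "'a ^ 2"
    assume u: "u \<in> nonzero_vectors" and v: "v \<in> nonzero_vectors"
    have move: "(h ** s) *v u = v \<longleftrightarrow> s *v u = B *v v" for s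
      using B by (metis matrix_vector_mul_assoc matrix_vector_mul_lid)
    have "det B \<noteq> 0"
      using B(1) by (metis det_I det_mul mult_zero_right zero_neq_one)
    then have "B *v v \<in> nonzero_vectors"
      using v matrix_vector_mult_nonzero by (auto simp: nonzero_vectors_def)
    then have "\<exists>!s. s \<in> S \<and> s *v u = B *v v"
      using S(2) u unfolding sharply_transitive_on_def by blast
    then obtain s where s: "s \<in> S" "s *v u = B *v v" and
      unique: "\<And>s'. s' \<in> S \<Longrightarrow> s' *v u = B *v v \<Longrightarrow> s' = s"
      by blast
    show "\<exists>!A. A \<in> ?T \<and> A *v u = v"
    proof (rule ex1I[of _ "h ** s"])
      show "h ** s \<in> ?T \<and> (h ** s) *v u = v"
        using s move by blast
      show "A = h ** s" if "A \<in> ?T \<and> A *v u = v" for A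
        using that unique move by blast
    qed
  qed
  have "{A \<in> ?T. trace A = c} = (\<lambda>s. h ** s) ` {s \<in> S. trace (h ** s) = c}"
    by auto
  then have "card {A \<in> ?T. trace A = c} = card {s \<in> S. trace (h ** s) = c}"
    using card_image[OF inj] by simp
  then show ?thesis
    using card_trace_eq_mod[OF prime odd sharp det \<open>d \<noteq> 0\<close> nonsquare] by simp
qed

theorem theorem1p1:
  fixes p :: nat
  assumes "prime p"
    and "p \<ge> 13"
    and "CARD('a::{field,finite}) = p"
  shows "\<not> (\<exists>S. S \<subseteq> (SL2 :: ('a ^ 2 ^ 2) set) \<and>
            sharply_transitive_on (*v) (nonzero_vectors :: ('a ^ 2) set) S)"
proof
  assume "\<exists>S. S \<subseteq> (SL2 :: ('a ^ 2 ^ 2) set) \<and>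
            sharply_transitive_on (*v) (nonzero_vectors :: ('a ^ 2) set) S"
  then obtain S :: "('a ^ 2 ^ 2) set" where S: "S \<subseteq> SL2" "sharply_transitive_on (*v) nonzero_vectors S"
    by blast
  have prime: "prime CARD('a)" and p13: "13 \<le> CARD('a)"
    using assms by simp_all
  then have odd: "odd CARD('a)"
    by (intro prime_odd_nat) auto
  have char: "CHAR('a) = p"
    using CHAR_eq_card[OF prime] assms(3) by simp
  obtain k where k: "4 \<le> k" "k + 4 \<le> p" "3 * p < k * (p - k) + 3"
    and nonsquare_k: "\<nexists>y. y\<^sup>2 = (of_nat k)\<^sup>2 - (4 :: 'a)"
    using exists_nonsquare_discriminant[OF prime p13] assms(3) by metis
  \<comment> \<open>For determinant \<open>d\<close> and trace \<open>c\<close>, only the ratio \<open>c\<^sup>2 / d\<close> is invariant under scaling of \<open>h\<close>.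
    The choice \<open>c = d = k + 2\<close> gives the discriminant \<open>k\<^sup>2 - 4\<close> and the residue
    \<open>c\<^sup>2 / d - 3 = k - 1\<close>.\<close>
  define d :: 'a where "d = of_nat (k + 2)"
  have "d \<noteq> 0"
    unfolding d_def of_nat_eq_0_iff_char_dvd char using k by (auto dest: dvd_imp_le)
  have "d\<^sup>2 - 4 * d = (of_nat k)\<^sup>2 - 4"
    by (simp add: d_def power2_eq_square algebra_simps)
  then have nonsquare: "\<nexists>y. y\<^sup>2 = d\<^sup>2 - 4 * d"
    using nonsquare_k by simp
  define r where "r = int k - 1"
  define m where "m = (int p)\<^sup>2 - 1"
  define G where "G = {h :: 'a ^ 2 ^ 2. det h = d}"
  define \<Gamma> where "\<Gamma> = card {h :: 'a ^ 2 ^ 2. det h = d \<and> trace h = d}"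
  define N where "N h = card {s \<in> S. trace (h ** s) = d}" for h
  have m: "int (p\<^sup>2 - 1) = m"
    using assms(2) by (simp add: m_def of_nat_diff)
  have cardS: "int (card S) = m"
  proof -
    have "\<forall>A\<in>S. det A \<noteq> 0"
      using S(1) by (auto simp: SL2_def)
    then show ?thesis
      using card_sharply_transitive[OF S(2)] m assms(3) by simp
  qed
  have row: "card {h \<in> G. trace (h ** s) = d} = \<Gamma>" if "s \<in> S" for s
  proof -
    have "det s = 1"
      using S(1) that by (auto simp: SL2_def)
    then obtain B where "s ** B = mat 1" "B ** s = mat 1"
      by (metis invertible_def invertible_det_nz zero_neq_one)
    then show ?thesis
      using card_trace_eq_translate[OF \<open>det s = 1\<close>, of B d d "\<lambda>_. True"] by (simp add: G_def \<Gamma>_def)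
  qed
  have M1: "(\<Sum>h\<in>G. int (N h)) = m * \<Gamma>"
  proof -
    have "(\<Sum>h\<in>G. N h) = \<Gamma> * card S"
      unfolding N_def using row by (intro sum_multicount) auto
    then have "int (\<Sum>h\<in>G. N h) = m * \<Gamma>"
      by (simp add: cardS)
    then show ?thesis
      by simp
  qed
  have M2: "(\<Sum>h\<in>G. (int (N h))\<^sup>2) \<le> m * (\<Gamma> + int p * m)"
  proof -
    have nat_eq: "(\<Sum>h\<in>G. (N h)\<^sup>2) = (\<Sum>s\<in>S. \<Sum>t\<in>S. card {h \<in> G. trace (h ** s) = d \<and> trace (h ** t) = d})"
      unfolding N_def by (rule sum_card_power2) simp_all
    have "(\<Sum>h\<in>G. (int (N h))\<^sup>2) = int (\<Sum>h\<in>G. (N h)\<^sup>2)"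
      by simp
    also have "\<dots> = (\<Sum>s\<in>S. int (\<Sum>t\<in>S. card {h \<in> G. trace (h ** s) = d \<and> trace (h ** t) = d}))"
      unfolding nat_eq by (rule of_nat_sum)
    also have "\<dots> \<le> (\<Sum>s\<in>S. \<Gamma> + int p * m)"
    proof (rule sum_mono)
      fix s assume "s \<in> S"
      then have "(\<Sum>t\<in>S. card {h \<in> G. trace (h ** s) = d \<and> trace (h ** t) = d}) + (p\<^sup>2 - 1)
          \<le> \<Gamma> + (p + 1) * (p\<^sup>2 - 1)"
        using card_second_moment_row[OF nonsquare \<open>d \<noteq> 0\<close> S, of s]
        unfolding assms(3) \<Gamma>_def G_def by (simp only: mem_Collect_eq)
      then have "int (\<Sum>t\<in>S. card {h \<in> G. trace (h ** s) = d \<and> trace (h ** t) = d}) + m \<le> \<Gamma> + (int p + 1) * m"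
        unfolding of_nat_le_iff[symmetric, where 'a = int] by (simp only: of_nat_add of_nat_mult of_nat_1 m)
      then show "int (\<Sum>t\<in>S. card {h \<in> G. trace (h ** s) = d \<and> trace (h ** t) = d}) \<le> \<Gamma> + int p * m"
        by (simp only: distrib_right)
    qed
    finally show ?thesis
      by (simp add: cardS)
  qed
  \<comment> \<open>The two factors are consecutive multiples of \<open>p\<close>, so they cannot have opposite signs.\<close>
  have nonneg: "0 \<le> (int (N h) - r) * (int (N h) - r - int p)" if "h \<in> G" for h
  proof -
    have "of_nat (N h) = d\<^sup>2 / d - 3"
      unfolding N_def using that by (intro card_trace_product_mod[OF prime odd S _ \<open>d \<noteq> 0\<close> nonsquare]) (simp add: G_def)
    also have "\<dots> = of_int r"
      using \<open>d \<noteq> 0\<close> by (simp add: power2_eq_square) (simp add: d_def r_def)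
    finally have "of_int (int (N h) - r) = (0::'a)"
      by simp
    then obtain j where j: "int (N h) - r = int p * j"
      unfolding of_int_eq_0_iff_char_dvd char by (elim dvdE)
    have "0 \<le> j * (j - 1)"
      by (cases "j \<le> 0") (auto simp: mult_nonpos_nonpos)
    then have "0 \<le> (int p)\<^sup>2 * (j * (j - 1))"
      by simp
    then show ?thesis
      unfolding j by (simp add: power2_eq_square algebra_simps)
  qed
  have "0 \<le> (\<Sum>h\<in>G. (int (N h) - r) * (int (N h) - r - int p))"
    by (rule sum_nonneg) (rule nonneg)
  also have "\<dots> = (\<Sum>h\<in>G. (int (N h))\<^sup>2 - (2 * r + int p) * int (N h) + r * (r + int p))"
    by (rule sum.cong) (simp_all add: power2_eq_square algebra_simps)
  also have "\<dots> = (\<Sum>h\<in>G. (int (N h))\<^sup>2) - (2 * r + int p) * (m * \<Gamma>) + r * (r + int p) * int (card G)"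
    by (simp add: sum.distrib sum_subtractf sum_distrib_left[symmetric] M1)
  also have "\<dots> \<le> m * (\<Gamma> + int p * m) - (2 * r + int p) * (m * \<Gamma>) + r * (r + int p) * (int p * m)"
  proof -
    have "int (card G) \<le> int p * m"
      using card_det_le[OF \<open>d \<noteq> 0\<close>] unfolding assms(3) G_def m[symmetric] by (simp flip: of_nat_mult)
    moreover have "0 \<le> r * (r + int p)"
      using k by (simp add: r_def)
    ultimately show ?thesis
      by (intro add_mono diff_right_mono M2 mult_left_mono)
  qed
  also have "\<dots> = m * (int p * m + r * (r + int p) * int p - (2 * r + int p - 1) * \<Gamma>)"
    by (simp add: algebra_simps)
  also have "\<dots> \<le> m * (int p * m + r * (r + int p) * int p - (2 * r + int p - 1) * (int p * (int p - 1)))"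
  proof -
    have "int (p * (p - 1)) \<le> int \<Gamma>"
      using card_det_trace_ge[of d d] unfolding assms(3) \<Gamma>_def of_nat_le_iff .
    then have "int p * (int p - 1) \<le> \<Gamma>"
      using assms(2) by (simp add: of_nat_diff)
    then show ?thesis
      using k assms(2) by (intro mult_left_mono diff_left_mono) (auto simp: r_def m_def)
  qed
  also have "\<dots> = m * int p * (3 * int p - 3 - int k * (int p - int k))"
    by (simp add: m_def r_def power2_eq_square algebra_simps)
  finally have "0 \<le> m * int p * (3 * int p - 3 - int k * (int p - int k))" .
  moreover have "3 * int p - 3 - int k * (int p - int k) < 0"
  proof -
    have "int (3 * p) < int (k * (p - k) + 3)"
      using k(3) by (simp only: of_nat_less_iff)
    then show ?thesis
      using k(2) by (simp add: of_nat_diff)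
  qed
  moreover have "0 < m * int p"
    using assms(2) by (simp add: m_def)
  ultimately show False
    by (simp add: zero_le_mult_iff)
qed

end
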